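(* Assume the observation model, the exchangeable exponential moment condition on $\xi$ with constants $\beta\in(0,1]$, $B>0$, and the empirical Bayes construction with prior parameter $\varkappa$ described in the context, and assume $\varkappa>\bar\varkappa:=(12-\beta+4B)/(4\beta)$. Let $(\hat\pi(\vartheta|X),\hat\theta)$ be either $(\tilde\pi(\vartheta|X),\tilde\theta)$ or $(\check\pi(\vartheta|X),\check\theta)$, and $\hat r^2=\sigma^2+\sigma^2|\hat I|\log(en/|\hat I|)$. Then there exist positive constants $M_0,H_0,m_0,M_1,H_1,m_1,M_0',H_0'$, depending only on $\beta,B,\varkappa$, such that, for $p_n\in[n]$ with $p_n=o(n)$ as $n\to\infty$ and $\ell_0[p_n]=\{\theta\in\mathbb{R}^n:|\{i\in[n]:\theta_i\ne0\}|\le p_n\}$, for any $M\ge0$ $$\sup_{\theta\in\ell_0[p_n]}\mathrm{E}_\theta\hat\pi\big(\|\vartheta-\theta\|^2\ge M_0\sigma^2p_n\log(\tfrac{en}{p_n})+M\sigma^2\,\big|\,X\big)\le H_0e^{-m_0M},$$ $$\sup_{\theta\in\ell_0[p_n]}\mathrm{P}_\theta\big(\|\hat\theta-\theta\|^2\ge M_1\sigma^2p_n\log(\tfrac{en}{p_n})+M\sigma^2\big)\le H_1e^{-m_1M},$$ $$\sup_{\theta\in\ell_0[p_n]}\mathrm{P}_\theta\big(\hat r^2\ge M_0'\sigma^2p_n\log(\tfrac{en}{p_n})+(M+1)\sigma^2\big)\le H_0'e^{-M}.$$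
   Context: Model. $n\in\mathbb{N}$, $[n]=\{1,\dots,n\}$, $\sigma>0$ known, $\theta\in\mathbb{R}^n$ unknown. One observes $X=(X_1,\dots,X_n)$, $X_i=\theta_i+\sigma\xi_i$, $i\in[n]$, where $\xi=(\xi_1,\dots,\xi_n)$ is a random vector (its distribution is unknown, may depend on $\theta$, and its coordinates need not be independent or normal) with $\mathrm{E}\xi_i=0$, $\mathrm{Var}(\xi_i)\le 1$. $\mathrm{P}_\theta,\mathrm{E}_\theta$ denote the law of $X$ and its expectation. $\|\cdot\|$ is the Euclidean norm. $\beta,B,\varkappa$ do not depend on $n$. Exchangeable exponential moment condition with constants $\beta\in(0,1]$, $B>0$: $\mathrm{E}\exp\{\beta\sum_{i\in I}\xi_i^2\}\le e^{B|I|}$ for all $I\subseteq[n]$ (for every $\theta$, if the law of $\xi$ depends on $\theta$). Conventions. $\mathcal{I}$ is the family of all subsets of $[n]$ (including $\varnothing$), $I^c=[n]\setminus I$, $0\log(c/0)=0$ and $(c/0)^0=1$ for $c>0$, $\mathrm{N}(\mu,0)=\delta_\mu$ is the Dirac measure, $\phi(x,\mu,s^2)$ is the $\mathrm{N}(\mu,s^2)$ density at $x$, $X(I)=(X_i\mathbf{1}\{i\in I\})_{i\in[n]}$. Empirical Bayes construction. Fix $\varkappa>1$. Let $\lambda_I=c_{\varkappa,n}(en/|I|)^{-\varkappa|I|}$, $I\in\mathcal{I}$, with $c_{\varkappa,n}$ normalizing so that $\sum_{I}\lambda_I=1$; $K_n(I)=(\frac{en}{|I|}-1)\mathbf{1}\{I\ne\varnothing\}$;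 $\tau_i^2(I)=\sigma^2K_n(I)\mathbf{1}\{i\in I\}$; $\mathrm{P}_{X,I}=\prod_{i=1}^n\phi(X_i,X_i\mathbf{1}\{i\in I\},\sigma^2+\tau_i^2(I))$. Define - $\tilde\pi(I|X)=\lambda_I\mathrm{P}_{X,I}/\sum_{J\in\mathcal{I}}\lambda_J\mathrm{P}_{X,J}$; - $\tilde\pi_I(\vartheta|X)=\bigotimes_{i=1}^n\mathrm{N}\big(X_i\mathbf{1}\{i\in I\},\frac{K_n(I)\sigma^2\mathbf{1}\{i\in I\}}{K_n(I)+1}\big)$, a distribution for $\vartheta\in\mathbb{R}^n$; - $\tilde\pi(\vartheta|X)=\sum_{I}\tilde\pi_I(\vartheta|X)\tilde\pi(I|X)$, with mean $\tilde\theta=\sum_IX(I)\tilde\pi(I|X)$; - $\hat I$ any maximizer of $\tilde\pi(I|X)$ over $I\in\mathcal{I}$, equivalently any minimizer of $\sum_{i\in I^c}X_i^2+(2\varkappa+1)\sigma^2|I|\log(\frac{en}{|I|})$; - $\check\pi(\vartheta|X)=\tilde\pi_{\hat I}(\vartheta|X)$, with mean $\check\theta=X(\hat I)$. *)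

theory Defs
  imports "HOL-Probability.Probability" "HOL-Library.Landau_Symbols"
begin

text \<open>
  The space R^n is rendered as the space of the product measure space over the index set
  \<open>{1..n}\<close>: a vector is a function that is \<open>undefined\<close> outside \<open>{1..n}\<close>.
\<close>

abbreviation Rn :: "nat \<Rightarrow> (nat \<Rightarrow> real) measure" where
  "Rn n \<equiv> \<Pi>\<^sub>M i\<in>{1..n}. (borel :: real measure)"

text \<open>The squared Euclidean distance in R^n.\<close>

definition sqdist :: "nat \<Rightarrow> (nat \<Rightarrow> real) \<Rightarrow> (nat \<Rightarrow> real) \<Rightarrow> real" where
  "sqdist n x y = (L2_set (\<lambda>i. x i - y i) {1..n})\<^sup>2"

definition ell0 :: "nat \<Rightarrow> nat \<Rightarrow> (nat \<Rightarrow> real) set" where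
  "ell0 n p = {\<theta> \<in> space (Rn n). card {i \<in> {1..n}. \<theta> i \<noteq> 0} \<le> p}"

text \<open>
  \<open>noise_law n \<beta> B N\<close>: the measure \<open>N\<close> on R^n is an admissible law of the noise vector. The
  exponential moment is a nonnegative integral, so that an infinite moment violates the bound.
\<close>

definition noise_law :: "nat \<Rightarrow> real \<Rightarrow> real \<Rightarrow> (nat \<Rightarrow> real) measure \<Rightarrow> bool" where
  "noise_law n \<beta> B N \<longleftrightarrow>
     prob_space N \<and> sets N = sets (Rn n) \<and>
     (\<forall>i\<in>{1..n}. integrable N (\<lambda>\<xi>. \<xi> i) \<and> prob_space.expectation N (\<lambda>\<xi>. \<xi> i) = 0 \<and>
        integrable N (\<lambda>\<xi>. (\<xi> i)\<^sup>2) \<and> prob_space.variance N (\<lambda>\<xi>. \<xi> i) \<le> 1) \<and>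
     (\<forall>I. I \<subseteq> {1..n} \<longrightarrow>
        (\<integral>\<^sup>+\<xi>. ennreal (exp (\<beta> * (\<Sum>i\<in>I. (\<xi> i)\<^sup>2))) \<partial>N) \<le> ennreal (exp (B * real (card I))))"

text \<open>
  The law of the observation \<open>X\<^sub>i = \<theta>\<^sub>i + \<sigma> \<xi>\<^sub>i\<close>, where \<open>N \<theta>\<close> is the law of \<open>\<xi>\<close> (it may depend
  on the parameter \<open>\<theta>\<close>).
\<close>

definition obs_law ::
  "nat \<Rightarrow> real \<Rightarrow> ((nat \<Rightarrow> real) \<Rightarrow> (nat \<Rightarrow> real) measure) \<Rightarrow> (nat \<Rightarrow> real) \<Rightarrow> (nat \<Rightarrow> real) measure" where
  "obs_law n \<sigma> N \<theta> = distr (N \<theta>) (Rn n) (\<lambda>\<xi>. \<lambda>i\<in>{1..n}. \<theta> i + \<sigma> * \<xi> i)"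

text \<open>
  Densities and laws of normal distributions are parametrized by mean and variance here, whereas
  \<^const>\<open>normal_density\<close> takes the standard deviation; variance zero gives the Dirac measure.
\<close>

definition phi :: "real \<Rightarrow> real \<Rightarrow> real \<Rightarrow> real" where
  "phi x \<mu> v = normal_density \<mu> (sqrt v) x"

definition normal_law :: "real \<Rightarrow> real \<Rightarrow> real measure" where
  "normal_law \<mu> v =
     (if v = 0 then return borel \<mu> else density lborel (\<lambda>x. ennreal (phi x \<mu> v)))"

text \<open>
  The unnormalized prior weight of \<open>I\<close>. The empty set is treated separately because of the
  convention \<open>(c/0)\<^sup>0 = 1\<close>: here \<open>c / 0 = 0\<close> and \<open>0 powr 0 = 0\<close>.
\<close>

definition prior_weight :: "nat \<Rightarrow> real \<Rightarrow> nat set \<Rightarrow> real" where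
  "prior_weight n \<kappa> I =
     (if I = {} then 1
      else (exp 1 * real n / real (card I)) powr (- \<kappa> * real (card I)))"

definition prior :: "nat \<Rightarrow> real \<Rightarrow> nat set \<Rightarrow> real" where
  "prior n \<kappa> I = prior_weight n \<kappa> I / (\<Sum>J\<in>Pow {1..n}. prior_weight n \<kappa> J)"

definition Kn :: "nat \<Rightarrow> nat set \<Rightarrow> real" where
  "Kn n I = (if I = {} then 0 else exp 1 * real n / real (card I) - 1)"

definition tau2 :: "nat \<Rightarrow> real \<Rightarrow> nat set \<Rightarrow> nat \<Rightarrow> real" where
  "tau2 n \<sigma> I i = (if i \<in> I then \<sigma>\<^sup>2 * Kn n I else 0)"

definition proj :: "nat \<Rightarrow> (nat \<Rightarrow> real) \<Rightarrow> nat set \<Rightarrow> nat \<Rightarrow> real" where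
  "proj n X I = (\<lambda>i\<in>{1..n}. if i \<in> I then X i else 0)"

definition marginal :: "nat \<Rightarrow> real \<Rightarrow> (nat \<Rightarrow> real) \<Rightarrow> nat set \<Rightarrow> real" where
  "marginal n \<sigma> X I = (\<Prod>i\<in>{1..n}. phi (X i) (proj n X I i) (\<sigma>\<^sup>2 + tau2 n \<sigma> I i))"

definition post_weight :: "nat \<Rightarrow> real \<Rightarrow> real \<Rightarrow> (nat \<Rightarrow> real) \<Rightarrow> nat set \<Rightarrow> real" where
  "post_weight n \<sigma> \<kappa> X I =
     prior n \<kappa> I * marginal n \<sigma> X I / (\<Sum>J\<in>Pow {1..n}. prior n \<kappa> J * marginal n \<sigma> X J)"

definition cond_post :: "nat \<Rightarrow> real \<Rightarrow> nat set \<Rightarrow> (nat \<Rightarrow> real) \<Rightarrow> (nat \<Rightarrow> real) measure" where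
  "cond_post n \<sigma> I X =
     (\<Pi>\<^sub>M i\<in>{1..n}. normal_law (proj n X I i) (if i \<in> I then Kn n I * \<sigma>\<^sup>2 / (Kn n I + 1) else 0))"

text \<open>The mixture of the measures \<open>cond_post n \<sigma> I X\<close> with weights \<open>post_weight n \<sigma> \<kappa> X I\<close>.\<close>

definition mix_post :: "nat \<Rightarrow> real \<Rightarrow> real \<Rightarrow> (nat \<Rightarrow> real) \<Rightarrow> (nat \<Rightarrow> real) measure" where
  "mix_post n \<sigma> \<kappa> X =
     point_measure (Pow {1..n}) (\<lambda>I. ennreal (post_weight n \<sigma> \<kappa> X I)) \<bind> (\<lambda>I. cond_post n \<sigma> I X)"

definition mix_mean :: "nat \<Rightarrow> real \<Rightarrow> real \<Rightarrow> (nat \<Rightarrow> real) \<Rightarrow> nat \<Rightarrow> real" where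
  "mix_mean n \<sigma> \<kappa> X =
     (\<lambda>i\<in>{1..n}. \<Sum>I\<in>Pow {1..n}. proj n X I i * post_weight n \<sigma> \<kappa> X I)"

text \<open>
  \<open>Ihat\<close> is a measurable choice of a maximizer of the posterior weights, ties being broken
  arbitrarily.
\<close>

definition selector :: "nat \<Rightarrow> real \<Rightarrow> real \<Rightarrow> ((nat \<Rightarrow> real) \<Rightarrow> nat set) \<Rightarrow> bool" where
  "selector n \<sigma> \<kappa> Ihat \<longleftrightarrow>
     Ihat \<in> Rn n \<rightarrow>\<^sub>M count_space (Pow {1..n}) \<and>
     (\<forall>X\<in>space (Rn n). is_arg_max (post_weight n \<sigma> \<kappa> X) (\<lambda>I. I \<subseteq> {1..n}) (Ihat X))"

definition sel_post ::
  "nat \<Rightarrow> real \<Rightarrow> ((nat \<Rightarrow> real) \<Rightarrow> nat set) \<Rightarrow> (nat \<Rightarrow> real) \<Rightarrow> (nat \<Rightarrow> real) measure" where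
  "sel_post n \<sigma> Ihat X = cond_post n \<sigma> (Ihat X) X"

definition sel_mean :: "nat \<Rightarrow> ((nat \<Rightarrow> real) \<Rightarrow> nat set) \<Rightarrow> (nat \<Rightarrow> real) \<Rightarrow> nat \<Rightarrow> real" where
  "sel_mean n Ihat X = proj n X (Ihat X)"

definition rhat2 :: "nat \<Rightarrow> real \<Rightarrow> ((nat \<Rightarrow> real) \<Rightarrow> nat set) \<Rightarrow> (nat \<Rightarrow> real) \<Rightarrow> real" where
  "rhat2 n \<sigma> Ihat X =
     \<sigma>\<^sup>2 + \<sigma>\<^sup>2 * real (card (Ihat X)) * ln (exp 1 * real n / real (card (Ihat X)))"

end

theory Submission
  imports Defs
begin

text \<open>
  Write \<open>\<rho>(I) = |I| log(en/|I|)\<close> and \<open>S\<close> for the support of \<open>\<theta>\<close>. The posterior weight of \<open>I\<close> and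
  the indicator of \<open>Ihat = I\<close> are both at most the posterior ratio of \<open>I\<close> to \<open>S\<close> raised to
  the power \<open>\<beta>\<close>. Even after multiplication by \<open>exp (\<beta> |X(I) - \<theta>|\<^sup>2 / (4 \<sigma>\<^sup>2))\<close> this ratio is
  bounded by \<open>exp (- \<beta> (\<kappa> + 1/2) (\<rho>(I) - \<rho>(S)))\<close> times the exponential of \<open>\<beta>\<close> times the noise energy
  over \<open>I \<union> S\<close>, whose expectation is at most \<open>exp (B |I \<union> S|)\<close>. The condition on \<open>\<kappa>\<close> gives
  \<open>\<beta> (\<kappa> + 1/2) \<ge> 3 + B\<close>, and there are at most \<open>exp \<rho>(I)\<close> subsets of the size of \<open>I\<close>, so the sum over
  all \<open>I\<close>, even with an additional factor \<open>exp \<rho>(I)\<close>, has expectation of order \<open>exp (C \<rho>(p))\<close>.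
  All three bounds follow from this one by Markov's inequality: the first one after integrating the
  Gaussian conditional posteriors (which costs a factor \<open>exp |I|\<close>), the second by Jensen's
  inequality, the third directly.
\<close>

subsection \<open>The complexity function\<close>

definition rho :: "nat \<Rightarrow> nat \<Rightarrow> real" where
  "rho n k = real k * ln (exp 1 * real n / real k)"

lemma ln_ge_one:
  assumes "0 < k" "k \<le> n"
  shows "1 \<le> ln (exp 1 * real n / real k)"
proof -
  have "exp 1 * 1 \<le> exp 1 * (real n / real k)"
    using assms by (intro mult_left_mono) auto
  then show ?thesis
    using assms by (subst ln_ge_iff) auto
qed

lemma card_le_rho: "k \<le> n \<Longrightarrow> real k \<le> rho n k"
  unfolding rho_def using ln_ge_one[of k n] by (cases "k = 0") auto

text \<open>For \<open>j > 0\<close> put \<open>l = ln (e n / k) \<ge> 1\<close>. The logarithm at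
  \<open>j\<close> exceeds \<open>l\<close> by \<open>ln (k / j)\<close>, and
  \<open>j * ln (k / j) \<le> k - j \<le> (k - j) * l\<close>.\<close>

lemma rho_mono:
  assumes "j \<le> k" "k \<le> n"
  shows "rho n j \<le> rho n k"
proof (cases "j = 0")
  case True
  then show ?thesis using card_le_rho[OF assms(2)] by (simp add: rho_def)
next
  case False
  then have pos: "0 < real j" "0 < real k" "0 < real n" using assms by auto
  define l where "l = ln (exp 1 * real n / real k)"
  have l1: "1 \<le> l" unfolding l_def using pos assms by (intro ln_ge_one) auto
  have "ln (exp 1 * real n / real j) = l + ln (real k / real j)"
    unfolding l_def using pos by (simp add: ln_mult ln_div)
  moreover have "real j * ln (real k / real j) \<le> real j * (real k / real j - 1)"
    using pos by (intro mult_left_mono ln_le_minus_one) auto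
  moreover have "real j * (real k / real j - 1) = real k - real j"
    using pos by (simp add: field_simps)
  moreover have "(real k - real j) * 1 \<le> (real k - real j) * l"
    using l1 assms by (intro mult_left_mono) auto
  ultimately show ?thesis
    unfolding rho_def l_def[symmetric] by (simp add: algebra_simps)
qed

text \<open>The classical bound by \<open>(e n / k) ^ k\<close>: the binomial coefficient is at most
  \<open>n ^ k / k!\<close>, and \<open>k ^ k / k!\<close> is a single term of the series of
  \<open>exp k\<close>.\<close>

lemma choose_le_exp_rho:
  assumes "k \<le> n"
  shows "real (n choose k) \<le> exp (rho n k)"
proof (cases "k = 0")
  case True
  then show ?thesis by (simp add: rho_def)
next
  case False
  have "(\<lambda>i. inverse (fact i) *\<^sub>R real k ^ i) sums exp (real k)" by (rule exp_converges)
  then have ek: "real k ^ k / fact k \<le> exp (real k)"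
    using sum_le_suminf[of "\<lambda>i. inverse (fact i) *\<^sub>R real k ^ i" "{k}"]
    by (simp add: sums_iff field_simps)
  have "real (n choose k) * fact k \<le> real n ^ k"
    using binomial_fact_pow[of n k] by (metis of_nat_fact of_nat_le_iff of_nat_mult of_nat_power)
  then have "real (n choose k) \<le> real n ^ k / fact k"
    by (simp add: field_simps)
  also have "\<dots> = (real n / real k) ^ k * (real k ^ k / fact k)"
    using False by (simp add: power_divide)
  also have "\<dots> \<le> (real n / real k) ^ k * exp (real k)"
    by (intro mult_left_mono ek) auto
  also have "\<dots> = (exp 1 * real n / real k) ^ k"
    by (simp add: exp_of_nat_mult[of k 1, simplified] power_mult_distrib power_divide)
  also have "\<dots> = exp (rho n k)"
    using False assms by (simp add: rho_def exp_of_nat_mult)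
  finally show ?thesis .
qed

text \<open>Grouped by size, the subsets of size \<open>k\<close> use up one of the two factors
  \<open>exp (- rho n k)\<close>. The other is at most \<open>exp (- k) \<le> (1/2) ^ k\<close>,
  which leaves a geometric sum.\<close>

lemma sum_subsets_exp_rho_le:
  "(\<Sum>I\<in>Pow {1..n}. exp (- 2 * rho n (card I))) \<le> 2"
proof -
  have "(\<Sum>I\<in>Pow {1..n}. exp (- 2 * rho n (card I)))
      = (\<Sum>k\<le>n. \<Sum>I\<in>{I \<in> Pow {1..n}. card I = k}. exp (- 2 * rho n (card I)))"
    by (intro sum.group[symmetric]) (auto intro!: card_mono[of "{1..n}", simplified])
  also have "\<dots> = (\<Sum>k\<le>n. real (n choose k) * exp (- 2 * rho n k))"
    using n_subsets[of "{1..n}"] by (intro sum.cong) auto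
  also have "\<dots> \<le> (\<Sum>k\<le>n. (1/2) ^ k)"
  proof (intro sum_mono)
    fix k assume "k \<in> {..n}"
    then have k: "k \<le> n" by simp
    have "real (n choose k) * exp (- 2 * rho n k) \<le> exp (rho n k) * exp (- 2 * rho n k)"
      by (intro mult_right_mono choose_le_exp_rho k) auto
    also have "\<dots> = exp (- rho n k)" by (simp flip: exp_add)
    also have "\<dots> \<le> exp (- real k)" using card_le_rho[OF k] by simp
    also have "\<dots> = exp (- 1) ^ k" by (simp flip: exp_of_nat_mult)
    also have "\<dots> \<le> (1/2) ^ k"
      using exp_ge_add_one_self[of 1] by (intro power_mono) (auto simp: exp_minus field_simps)
    finally show "real (n choose k) * exp (- 2 * rho n k) \<le> (1/2) ^ k" .
  qed
  also have "\<dots> = 2 - (1/2) ^ n"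
    by (induction n) (auto simp: field_simps)
  also have "\<dots> \<le> 2"
    by simp
  finally show ?thesis .
qed

subsection \<open>Posterior weights\<close>

text \<open>Logarithm of prior weight times marginal density, up to a term that does not depend on
  \<open>I\<close>. Multiplied by \<open>- 2 * \<sigma>\<^sup>2\<close> it is the penalized
  criterion that the selected subset minimizes.\<close>

definition log_weight :: "nat \<Rightarrow> real \<Rightarrow> real \<Rightarrow> (nat \<Rightarrow> real) \<Rightarrow> nat set \<Rightarrow> real" where
  "log_weight n \<sigma> \<kappa> X I =
     - (\<kappa> + 1/2) * rho n (card I) - (\<Sum>i\<in>{1..n}. if i \<in> I then 0 else (X i)\<^sup>2 / (2 * \<sigma>\<^sup>2))"

text \<open>On the right the empty set fits the general formula because \<open>rho n 0 = 0\<close>,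
  in accordance with the convention for powers with exponent zero.\<close>

lemma prior_weight_eq:
  assumes "I \<subseteq> {1..n}"
  shows "prior_weight n \<kappa> I = exp (- \<kappa> * rho n (card I))"
proof (cases "I = {}")
  case True
  then show ?thesis by (simp add: prior_weight_def rho_def)
next
  case False
  with assms have "0 < card I" "0 < n"
    using finite_subset by (auto simp: card_gt_0_iff)
  then show ?thesis using False by (simp add: prior_weight_def rho_def powr_def)
qed

text \<open>On \<open>I\<close> each density is evaluated at its own mean, so only the variance
  \<open>\<sigma>\<^sup>2 * exp l\<close> matters and contributes \<open>exp (- l / 2)\<close>. This
  is the source of the 1/2 next to \<open>\<kappa>\<close> in \<open>log_weight\<close>.\<close>

lemma marginal_eq:
  assumes "I \<subseteq> {1..n}" "0 < \<sigma>"
  shows "marginal n \<sigma> X I = (1 / sqrt (2 * pi * \<sigma>\<^sup>2)) ^ n *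
    exp (- (1/2) * rho n (card I) - (\<Sum>i\<in>{1..n}. if i \<in> I then 0 else (X i)\<^sup>2 / (2 * \<sigma>\<^sup>2)))"
proof -
  define l where "l = ln (exp 1 * real n / real (card I))"
  have fin: "finite I" using assms finite_subset by blast
  have "phi (X i) (proj n X I i) (\<sigma>\<^sup>2 + tau2 n \<sigma> I i) = 1 / sqrt (2 * pi * \<sigma>\<^sup>2) *
      exp (- (if i \<in> I then l / 2 else 0) - (if i \<in> I then 0 else (X i)\<^sup>2 / (2 * \<sigma>\<^sup>2)))"
    if i: "i \<in> {1..n}" for i
  proof (cases "i \<in> I")
    case True
    then have "0 < card I" using fin by (auto simp: card_gt_0_iff)
    moreover have "0 < n" using i by auto
    ultimately have e: "exp 1 * real n / real (card I) = exp l"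
      by (simp add: l_def)
    have "\<sigma>\<^sup>2 + tau2 n \<sigma> I i = \<sigma>\<^sup>2 * (exp 1 * real n / real (card I))"
      using True by (auto simp: tau2_def Kn_def algebra_simps)
    then have "\<sigma>\<^sup>2 + tau2 n \<sigma> I i = \<sigma>\<^sup>2 * exp l"
      unfolding e .
    moreover have "sqrt (exp l) = exp (l / 2)"
      by (intro real_sqrt_unique) (simp_all flip: exp_of_nat_mult)
    ultimately show ?thesis
      using True i assms(2)
      by (simp add: phi_def proj_def normal_density_def real_sqrt_mult exp_minus field_simps)
  next
    case False
    then show ?thesis
      using i assms(2) by (simp add: phi_def proj_def normal_density_def tau2_def)
  qed
  then have "marginal n \<sigma> X I = (\<Prod>i\<in>{1..n}. 1 / sqrt (2 * pi * \<sigma>\<^sup>2) *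
      exp (- (if i \<in> I then l / 2 else 0) - (if i \<in> I then 0 else (X i)\<^sup>2 / (2 * \<sigma>\<^sup>2))))"
    unfolding marginal_def by (intro prod.cong) auto
  also have "\<dots> = (1 / sqrt (2 * pi * \<sigma>\<^sup>2)) ^ n * exp (- (\<Sum>i\<in>{1..n}. if i \<in> I then l / 2 else 0)
      - (\<Sum>i\<in>{1..n}. if i \<in> I then 0 else (X i)\<^sup>2 / (2 * \<sigma>\<^sup>2)))"
    unfolding prod.distrib by (simp add: sum_subtractf sum_negf flip: exp_sum)
  also have "(\<Sum>i\<in>{1..n}. if i \<in> I then l / 2 else 0) = (1/2) * rho n (card I)"
    using assms(1) by (simp add: sum.If_cases Int_absorb1 rho_def l_def)
  finally show ?thesis by simp
qed

text \<open>The normalizing constants of the prior and of the Gaussian densities are common to all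
  subsets and cancel.\<close>

lemma post_weight_eq:
  assumes "I \<subseteq> {1..n}" "0 < \<sigma>"
  shows "post_weight n \<sigma> \<kappa> X I =
    exp (log_weight n \<sigma> \<kappa> X I) / (\<Sum>J\<in>Pow {1..n}. exp (log_weight n \<sigma> \<kappa> X J))"
proof -
  define C where "C = (1 / sqrt (2 * pi * \<sigma>\<^sup>2)) ^ n / (\<Sum>J\<in>Pow {1..n}. prior_weight n \<kappa> J)"
  have "0 < (\<Sum>J\<in>Pow {1..n}. prior_weight n \<kappa> J)"
    by (intro sum_pos) (auto simp: prior_weight_eq)
  then have C: "0 < C" using assms(2) by (simp add: C_def)
  have "prior n \<kappa> J * marginal n \<sigma> X J = C * exp (log_weight n \<sigma> \<kappa> X J)"
    if "J \<subseteq> {1..n}" for J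
    using that assms(2)
    by (simp add: prior_def prior_weight_eq marginal_eq C_def log_weight_def algebra_simps
        flip: exp_add)
  then have "post_weight n \<sigma> \<kappa> X I = C * exp (log_weight n \<sigma> \<kappa> X I) /
      (\<Sum>J\<in>Pow {1..n}. C * exp (log_weight n \<sigma> \<kappa> X J))"
    using assms(1) unfolding post_weight_def
    by (intro arg_cong2[where f = "(/)"] sum.cong) auto
  then show ?thesis using C by (simp flip: sum_distrib_left)
qed

lemma sum_exp_log_weight_pos: "0 < (\<Sum>J\<in>Pow {1..n}. exp (log_weight n \<sigma> \<kappa> X J))"
  by (intro sum_pos) auto

lemma post_weight_nonneg: "I \<subseteq> {1..n} \<Longrightarrow> 0 < \<sigma> \<Longrightarrow> 0 \<le> post_weight n \<sigma> \<kappa> X I"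
  by (simp add: post_weight_eq sum_nonneg)

lemma sum_post_weight: "0 < \<sigma> \<Longrightarrow> (\<Sum>I\<in>Pow {1..n}. post_weight n \<sigma> \<kappa> X I) = 1"
  using sum_exp_log_weight_pos[of n \<sigma> \<kappa> X]
  by (subst sum.cong[OF refl post_weight_eq]) (auto simp flip: sum_divide_distrib)

text \<open>With \<open>d\<close> the log ratio, the weight is at most 1 and at most
  \<open>exp d\<close>. The first bound suffices for \<open>d \<ge> 0\<close>, the second for
  \<open>d < 0\<close> because \<open>\<beta> \<le> 1\<close>. The power \<open>\<beta>\<close> is
  the one that the exponential moment of the noise can absorb.\<close>

lemma post_weight_le:
  assumes "I \<subseteq> {1..n}" "J \<subseteq> {1..n}" "0 < \<sigma>" "0 < \<beta>" "\<beta> \<le> 1"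
  shows "post_weight n \<sigma> \<kappa> X I \<le> exp (\<beta> * (log_weight n \<sigma> \<kappa> X I - log_weight n \<sigma> \<kappa> X J))"
proof -
  define d where "d = log_weight n \<sigma> \<kappa> X I - log_weight n \<sigma> \<kappa> X J"
  let ?S = "\<Sum>J\<in>Pow {1..n}. exp (log_weight n \<sigma> \<kappa> X J)"
  have le: "exp (log_weight n \<sigma> \<kappa> X K) \<le> ?S" if "K \<subseteq> {1..n}" for K
    using that by (intro member_le_sum) auto
  have "post_weight n \<sigma> \<kappa> X I \<le> 1"
    using le[OF assms(1)] sum_exp_log_weight_pos[of n \<sigma> \<kappa> X] assms by (simp add: post_weight_eq)
  moreover have "post_weight n \<sigma> \<kappa> X I \<le> exp d"
  proof -
    have "post_weight n \<sigma> \<kappa> X I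
        \<le> exp (log_weight n \<sigma> \<kappa> X I) / exp (log_weight n \<sigma> \<kappa> X J)"
      unfolding post_weight_eq[OF assms(1,3)]
      using le[OF assms(2)] sum_exp_log_weight_pos[of n \<sigma> \<kappa> X]
      by (intro divide_left_mono) auto
    then show ?thesis by (simp add: d_def exp_diff)
  qed
  moreover have "1 \<le> exp (\<beta> * d) \<or> exp d \<le> exp (\<beta> * d)"
  proof (cases "0 \<le> d")
    case False
    then have "1 * d \<le> \<beta> * d" using assms by (intro mult_right_mono_neg) auto
    then show ?thesis by simp
  qed (use assms in simp)
  ultimately show ?thesis unfolding d_def by linarith
qed

text \<open>All posterior weights share one denominator, so a maximizer of the weights also
  maximizes \<open>log_weight\<close>.\<close>

lemma selector_log_weight_le:
  assumes "selector n \<sigma> \<kappa> Ihat" "X \<in> space (Rn n)" "J \<subseteq> {1..n}" "0 < \<sigma>"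
  shows "Ihat X \<subseteq> {1..n}" "log_weight n \<sigma> \<kappa> X J \<le> log_weight n \<sigma> \<kappa> X (Ihat X)"
proof -
  have *: "is_arg_max (post_weight n \<sigma> \<kappa> X) (\<lambda>I. I \<subseteq> {1..n}) (Ihat X)"
    using assms by (simp add: selector_def)
  then show sub: "Ihat X \<subseteq> {1..n}" by (simp add: is_arg_max_def)
  have "post_weight n \<sigma> \<kappa> X J \<le> post_weight n \<sigma> \<kappa> X (Ihat X)"
    using * assms(3) by (auto simp: is_arg_max_def not_less)
  then show "log_weight n \<sigma> \<kappa> X J \<le> log_weight n \<sigma> \<kappa> X (Ihat X)"
    using sum_exp_log_weight_pos[of n \<sigma> \<kappa> X] assms sub
    by (simp add: post_weight_eq divide_le_cancel)
qed

lemma sqdist_eq_sum: "sqdist n x y = (\<Sum>i\<in>{1..n}. (x i - y i)\<^sup>2)"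
  by (simp add: sqdist_def L2_set_def sum_nonneg)

text \<open>
  On the support \<open>S\<close> of \<open>\<theta>\<close> a missed coordinate costs \<open>\<theta>\<^sub>i\<^sup>2/4\<close>, which the gain \<open>X\<^sub>i\<^sup>2/2\<close> in
  likelihood pays up to the noise; off the support \<open>X\<^sub>i\<close> is pure noise. Hence only noise terms
  over \<open>I \<union> S\<close> remain.
\<close>

lemma log_weight_diff_le:
  fixes n :: nat and X \<theta> :: "nat \<Rightarrow> real" and I :: "nat set"
  defines "S \<equiv> {i \<in> {1..n}. \<theta> i \<noteq> 0}"
  assumes "0 < \<sigma>" "I \<subseteq> {1..n}"
  shows "log_weight n \<sigma> \<kappa> X I - log_weight n \<sigma> \<kappa> X S + sqdist n (proj n X I) \<theta> / (4 * \<sigma>\<^sup>2)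
    \<le> (\<kappa> + 1/2) * (rho n (card S) - rho n (card I))
      + (\<Sum>i\<in>I \<union> S. ((X i - \<theta> i) / \<sigma>)\<^sup>2)"
proof -
  have "(if i \<in> S then 0 else (X i)\<^sup>2 / (2 * \<sigma>\<^sup>2)) - (if i \<in> I then 0 else (X i)\<^sup>2 / (2 * \<sigma>\<^sup>2))
      + (proj n X I i - \<theta> i)\<^sup>2 / (4 * \<sigma>\<^sup>2)
      \<le> (if i \<in> I \<union> S then ((X i - \<theta> i) / \<sigma>)\<^sup>2 else 0)" if i: "i \<in> {1..n}" for i
  proof -
    define x t where "x = X i / \<sigma>" and "t = \<theta> i / \<sigma>"
    have X: "X i = \<sigma> * x" "\<theta> i = \<sigma> * t" using assms(2) by (auto simp: x_def t_def)
    have t: "i \<notin> S \<Longrightarrow> t = 0" using i by (simp add: S_def t_def)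
    have a: "t\<^sup>2 / 4 - x\<^sup>2 / 2 \<le> (x - t)\<^sup>2"
    proof -
      have "(x - t)\<^sup>2 - (t\<^sup>2 / 4 - x\<^sup>2 / 2) = 3/4 * (t - 4/3 * x)\<^sup>2 + x\<^sup>2 / 6"
        by (simp add: power2_eq_square field_simps)
      moreover have "\<dots> \<ge> 0" by simp
      ultimately show ?thesis by linarith
    qed
    have e1: "(X i)\<^sup>2 / (2 * \<sigma>\<^sup>2) = x\<^sup>2 / 2"
      using assms(2) by (simp add: X power_mult_distrib)
    have e2: "(proj n X I i - \<theta> i)\<^sup>2 / (4 * \<sigma>\<^sup>2)
        = (if i \<in> I then (x - t)\<^sup>2 / 4 else t\<^sup>2 / 4)"
      using assms(2) i by (simp add: proj_def X power_mult_distrib flip: right_diff_distrib)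
    have e3: "(X i - \<theta> i) / \<sigma> = x - t"
      using assms(2) by (simp add: X flip: right_diff_distrib)
    \<comment> \<open>Four cases: on \<open>I \<inter> S\<close> the left side is
      \<open>(x - t)^2 / 4\<close>; on \<open>I - S\<close>, where \<open>t = 0\<close>, it is
      \<open>3/4 * x^2\<close>; on \<open>S - I\<close> it is the left side of \<open>a\<close>;
      elsewhere it vanishes.\<close>
    show ?thesis
      unfolding e1 e2 e3 using t a by auto
  qed
  then have "(\<Sum>i\<in>{1..n}. (if i \<in> S then 0 else (X i)\<^sup>2 / (2 * \<sigma>\<^sup>2))
      - (if i \<in> I then 0 else (X i)\<^sup>2 / (2 * \<sigma>\<^sup>2)) + (proj n X I i - \<theta> i)\<^sup>2 / (4 * \<sigma>\<^sup>2))
      \<le> (\<Sum>i\<in>{1..n}. if i \<in> I \<union> S then ((X i - \<theta> i) / \<sigma>)\<^sup>2 else 0)"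
    by (intro sum_mono)
  moreover have "(\<Sum>i\<in>{1..n}. if i \<in> I \<union> S then ((X i - \<theta> i) / \<sigma>)\<^sup>2 else 0)
      = (\<Sum>i\<in>I \<union> S. ((X i - \<theta> i) / \<sigma>)\<^sup>2)"
    using assms(3) by (subst sum.inter_restrict[symmetric])
      (auto simp: S_def intro!: arg_cong[where f = "sum _"])
  ultimately show ?thesis
    unfolding log_weight_def sqdist_eq_sum
    by (simp add: sum.distrib sum_subtractf sum_divide_distrib algebra_simps)
qed

subsection \<open>Expectations under the observation law\<close>

text \<open>No measurability is required of \<open>f\<close>: a non-integrable function has integral 0.\<close>

lemma integral_le_of_nn_integral_le:
  fixes f g :: "'a \<Rightarrow> real"
  assumes "\<And>x. x \<in> space M \<Longrightarrow> 0 \<le> f x" "\<And>x. x \<in> space M \<Longrightarrow> f x \<le> g x"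
    and "(\<integral>\<^sup>+x. ennreal (g x) \<partial>M) \<le> ennreal C" "0 \<le> C"
  shows "integral\<^sup>L M f \<le> C"
proof (cases "integrable M f")
  case True
  have "ennreal (integral\<^sup>L M f) = (\<integral>\<^sup>+x. ennreal (f x) \<partial>M)"
    using True assms(1) by (subst nn_integral_eq_integral) auto
  also have "\<dots> \<le> (\<integral>\<^sup>+x. ennreal (g x) \<partial>M)"
    using assms(2) by (intro nn_integral_mono ennreal_leI)
  also note assms(3)
  finally show ?thesis using assms(4) by simp
next
  case False
  then show ?thesis using assms(4) by (simp add: not_integrable_integral_eq)
qed

lemma sets_obs_law [simp]: "sets (obs_law n \<sigma> N \<theta>) = sets (Rn n)"
  by (simp add: obs_law_def)

lemma space_obs_law [simp]: "space (obs_law n \<sigma> N \<theta>) = space (Rn n)"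
  by (simp add: obs_law_def)

lemma borel_measurable_exp_sum:
  fixes \<theta> :: "nat \<Rightarrow> real"
  assumes "I \<subseteq> {1..n}"
  shows "(\<lambda>X. exp (\<beta> * (\<Sum>i\<in>I. ((X i - \<theta> i) / \<sigma>)\<^sup>2))) \<in> borel_measurable (Rn n)"
proof -
  have "(\<lambda>X. ((X i - \<theta> i) / \<sigma>)\<^sup>2) \<in> borel_measurable (Rn n)" if "i \<in> I" for i
  proof -
    have [measurable]: "(\<lambda>X. X i) \<in> borel_measurable (Rn n)"
      using that assms by (intro measurable_component_singleton) auto
    show ?thesis by measurable
  qed
  then have [measurable]:
    "(\<lambda>X. \<Sum>i\<in>I. ((X i - \<theta> i) / \<sigma>)\<^sup>2) \<in> borel_measurable (Rn n)"
    by (rule borel_measurable_sum)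
  show ?thesis by measurable
qed

text \<open>Here the exponential moment condition enters: standardizing the observation recovers the
  noise, so the bound carries over to the pushforward.\<close>

lemma nn_integral_obs_law_exp_le:
  assumes N: "noise_law n \<beta> B (N \<theta>)" and "0 < \<sigma>" "I \<subseteq> {1..n}"
  shows "(\<integral>\<^sup>+X. ennreal (exp (\<beta> * (\<Sum>i\<in>I. ((X i - \<theta> i) / \<sigma>)\<^sup>2))) \<partial>obs_law n \<sigma> N \<theta>)
    \<le> ennreal (exp (B * real (card I)))"
proof -
  let ?T = "\<lambda>\<xi>. \<lambda>i\<in>{1..n}. \<theta> i + \<sigma> * \<xi> i"
  have sets: "sets (N \<theta>) = sets (Rn n)" using N by (simp add: noise_law_def)
  have "?T \<in> Rn n \<rightarrow>\<^sub>M Rn n"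
    by (intro measurable_restrict) measurable
  then have T: "?T \<in> N \<theta> \<rightarrow>\<^sub>M Rn n"
    using measurable_cong_sets[OF sets refl] by blast
  have "(\<integral>\<^sup>+X. ennreal (exp (\<beta> * (\<Sum>i\<in>I. ((X i - \<theta> i) / \<sigma>)\<^sup>2))) \<partial>obs_law n \<sigma> N \<theta>)
      = (\<integral>\<^sup>+\<xi>. ennreal (exp (\<beta> * (\<Sum>i\<in>I. ((?T \<xi> i - \<theta> i) / \<sigma>)\<^sup>2))) \<partial>N \<theta>)"
    unfolding obs_law_def
    using borel_measurable_exp_sum[OF assms(3), THEN measurable_compose, OF measurable_ennreal]
    by (intro nn_integral_distr T) simp
  also have "\<dots> = (\<integral>\<^sup>+\<xi>. ennreal (exp (\<beta> * (\<Sum>i\<in>I. (\<xi> i)\<^sup>2))) \<partial>N \<theta>)"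
  proof -
    have "(\<Sum>i\<in>I. ((?T \<xi> i - \<theta> i) / \<sigma>)\<^sup>2) = (\<Sum>i\<in>I. (\<xi> i)\<^sup>2)" for \<xi>
      using assms by (intro sum.cong) auto
    then show ?thesis by simp
  qed
  also have "\<dots> \<le> ennreal (exp (B * real (card I)))"
    using N assms(3) by (simp add: noise_law_def)
  finally show ?thesis .
qed

text \<open>The central estimate. The factor \<open>exp (rho n (card I))\<close> is paid for here in
  advance: later it covers the Gaussian integral over the conditional posterior and controls the
  size of the selected subset. \<open>K\<close> is the scaling used with Markov's
  inequality.\<close>

lemma nn_integral_weighted_sum_le:
  fixes v :: "(nat \<Rightarrow> real) \<Rightarrow> nat set \<Rightarrow> real" and n p :: nat and \<beta> \<sigma> :: real and \<theta> :: "nat \<Rightarrow> real"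
  defines "G \<equiv> \<lambda>X I. exp (rho n (card I)) * v X I * exp (\<beta> * (sqdist n (proj n X I) \<theta> / (4 * \<sigma>\<^sup>2)))"
  assumes N: "noise_law n \<beta> B (N \<theta>)" and "0 < \<sigma>" "0 < \<beta>" "0 < B"
    and \<kappa>: "3 + B \<le> \<beta> * (\<kappa> + 1/2)" and \<theta>: "\<theta> \<in> ell0 n p" and "p \<le> n"
    and v: "\<And>X I. X \<in> space (Rn n) \<Longrightarrow> I \<subseteq> {1..n} \<Longrightarrow> v X I \<le>
      exp (\<beta> * (log_weight n \<sigma> \<kappa> X I - log_weight n \<sigma> \<kappa> X {i \<in> {1..n}. \<theta> i \<noteq> 0}))"
    and "0 < K"
  shows "(\<integral>\<^sup>+X. ennreal (K * (\<Sum>I\<in>Pow {1..n}. G X I)) \<partial>obs_law n \<sigma> N \<theta>)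
    \<le> ennreal (K * (2 * exp ((\<beta> * (\<kappa> + 1/2) + B) * rho n p)))"
proof -
  \<comment> \<open>This \<open>c\<close> leaves out the summand \<open>B\<close> that the
    \<open>c\<close> of \<open>tail_bounds\<close> contains.\<close>
  define c where "c = \<beta> * (\<kappa> + 1/2)"
  define S where "S = {i \<in> {1..n}. \<theta> i \<noteq> 0}"
  define e where "e X I = exp (\<beta> * (\<Sum>i\<in>I. ((X i - \<theta> i) / \<sigma>)\<^sup>2))" for X I
  define w where "w I = exp (rho n (card I) + c * (rho n (card S) - rho n (card I)))" for I :: "nat set"
  have cS: "card S \<le> p" using \<theta> by (simp add: ell0_def S_def)
  have G: "G X I \<le> w I * e X (I \<union> S)" if X: "X \<in> space (Rn n)" and I: "I \<subseteq> {1..n}" for X I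
  proof -
    let ?d = "log_weight n \<sigma> \<kappa> X I - log_weight n \<sigma> \<kappa> X S"
    let ?D = "sqdist n (proj n X I) \<theta> / (4 * \<sigma>\<^sup>2)"
    have "G X I \<le> exp (rho n (card I)) * exp (\<beta> * ?d) * exp (\<beta> * ?D)"
      unfolding G_def S_def using v[OF X I] by (intro mult_right_mono mult_left_mono) auto
    also have "\<dots> = exp (rho n (card I) + \<beta> * (?d + ?D))"
      by (simp add: algebra_simps flip: exp_add)
    also have "\<dots> \<le> exp (rho n (card I) + \<beta> * ((\<kappa> + 1/2) * (rho n (card S) - rho n (card I))
      + (\<Sum>i\<in>I \<union> S. ((X i - \<theta> i) / \<sigma>)\<^sup>2)))"
      using log_weight_diff_le[of \<sigma> I n \<kappa> X \<theta>] assms I unfolding S_def[symmetric]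
      by (simp add: mult_left_mono)
    also have "\<dots> = w I * e X (I \<union> S)"
      by (simp add: w_def e_def c_def algebra_simps flip: exp_add)
    finally show ?thesis .
  qed
  have S: "S \<subseteq> {1..n}" by (auto simp: S_def)
  have meas: "(\<lambda>X. ennreal (e X (I \<union> S))) \<in> borel_measurable (obs_law n \<sigma> N \<theta>)"
    if "I \<in> Pow {1..n}" for I
    unfolding e_def measurable_cong_sets[OF sets_obs_law refl] using that S
    by (intro measurable_compose[OF _ measurable_ennreal] borel_measurable_exp_sum) auto
  \<comment> \<open>Of the \<open>3 + B\<close> multiples of \<open>rho n (card I)\<close> that
    \<open>c\<close> provides, \<open>B\<close> pay for the noise over \<open>I\<close>, one for the
    extra factor in \<open>G\<close>, and two are left for the sum over subsets. The terms from
    \<open>S\<close> are charged to \<open>rho n p\<close>.\<close>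
  have w: "w I * exp (B * real (card (I \<union> S))) \<le> exp ((c + B) * rho n p) * exp (- 2 * rho n (card I))"
    if I: "I \<subseteq> {1..n}" for I
  proof -
    have "card I \<le> n" using card_mono[OF _ I] by simp
    then have 1: "real (card I) \<le> rho n (card I)" by (rule card_le_rho)
    have 2: "rho n (card S) \<le> rho n p" using cS \<open>p \<le> n\<close> by (rule rho_mono)
    have "real (card (I \<union> S)) \<le> rho n (card I) + rho n p"
      using card_Un_le[of I S] 1 cS card_le_rho[OF \<open>p \<le> n\<close>] by linarith
    then have 3: "B * real (card (I \<union> S)) \<le> B * (rho n (card I) + rho n p)"
      using \<open>0 < B\<close> by (intro mult_left_mono) auto
    have 4: "c * rho n (card S) \<le> c * rho n p"
      using 2 \<kappa> \<open>0 < B\<close> unfolding c_def by (intro mult_left_mono) auto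
    have 5: "(3 + B) * rho n (card I) \<le> c * rho n (card I)"
      using \<kappa> 1 unfolding c_def by (intro mult_right_mono) auto
    have "rho n (card I) + c * (rho n (card S) - rho n (card I)) + B * real (card (I \<union> S))
        \<le> (c + B) * rho n p + - 2 * rho n (card I)"
      using 3 4 5 by (simp add: algebra_simps)
    then show ?thesis by (simp add: w_def flip: exp_add)
  qed
  \<comment> \<open>Measurability is at hand for \<open>e\<close> only, so \<open>G\<close> is
    replaced by its bound before integral and sum are exchanged.\<close>
  have "(\<integral>\<^sup>+X. ennreal (K * (\<Sum>I\<in>Pow {1..n}. G X I)) \<partial>obs_law n \<sigma> N \<theta>)
      \<le> (\<integral>\<^sup>+X. (\<Sum>I\<in>Pow {1..n}. ennreal (K * w I) * ennreal (e X (I \<union> S))) \<partial>obs_law n \<sigma> N \<theta>)"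
  proof (intro nn_integral_mono)
    fix X assume "X \<in> space (obs_law n \<sigma> N \<theta>)"
    then have "(\<Sum>I\<in>Pow {1..n}. G X I) \<le> (\<Sum>I\<in>Pow {1..n}. w I * e X (I \<union> S))"
      by (intro sum_mono G) auto
    then have "ennreal (K * (\<Sum>I\<in>Pow {1..n}. G X I))
        \<le> ennreal (\<Sum>I\<in>Pow {1..n}. (K * w I) * e X (I \<union> S))"
      using \<open>0 < K\<close> by (intro ennreal_leI) (simp add: mult.assoc flip: sum_distrib_left)
    also have "\<dots> = (\<Sum>I\<in>Pow {1..n}. ennreal (K * w I) * ennreal (e X (I \<union> S)))"
      using \<open>0 < K\<close> by (subst sum_ennreal[symmetric]) (auto simp: w_def e_def ennreal_mult)
    finally show "ennreal (K * (\<Sum>I\<in>Pow {1..n}. G X I))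
      \<le> (\<Sum>I\<in>Pow {1..n}. ennreal (K * w I) * ennreal (e X (I \<union> S)))" .
  qed
  also have "\<dots> = (\<Sum>I\<in>Pow {1..n}.
      \<integral>\<^sup>+X. ennreal (K * w I) * ennreal (e X (I \<union> S)) \<partial>obs_law n \<sigma> N \<theta>)"
    by (intro nn_integral_sum borel_measurable_times_ennreal borel_measurable_const meas)
  also have "\<dots> = (\<Sum>I\<in>Pow {1..n}. ennreal (K * w I) * (\<integral>\<^sup>+X. ennreal (e X (I \<union> S)) \<partial>obs_law n \<sigma> N \<theta>))"
    by (intro sum.cong refl nn_integral_cmult meas)
  also have "\<dots> \<le> (\<Sum>I\<in>Pow {1..n}. ennreal (K * w I) * ennreal (exp (B * real (card (I \<union> S)))))"
    unfolding e_def using assms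
    by (intro sum_mono mult_left_mono nn_integral_obs_law_exp_le) (auto simp: S_def)
  also have "\<dots> = ennreal (\<Sum>I\<in>Pow {1..n}. K * w I * exp (B * real (card (I \<union> S))))"
    using \<open>0 < K\<close> by (subst sum_ennreal[symmetric]) (auto simp: w_def ennreal_mult)
  also have "\<dots> \<le> ennreal (\<Sum>I\<in>Pow {1..n}. K * exp ((c + B) * rho n p) * exp (- 2 * rho n (card I)))"
    unfolding mult.assoc using \<open>0 < K\<close>
    by (intro ennreal_leI sum_mono mult_left_mono[of _ _ K] w) auto
  also have "\<dots> \<le> ennreal (K * exp ((c + B) * rho n p) * 2)"
    using \<open>0 < K\<close> unfolding sum_distrib_left[symmetric]
    by (intro ennreal_leI mult_left_mono sum_subsets_exp_rho_le) auto
  finally show ?thesis by (simp add: c_def mult_ac)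
qed

subsection \<open>Tails of the conditional posteriors\<close>

lemma sets_normal_law [simp]: "sets (normal_law \<mu> v) = sets borel"
  by (simp add: normal_law_def)

lemma prob_space_normal_law:
  assumes "0 \<le> v"
  shows "prob_space (normal_law \<mu> v)"
proof (cases "v = 0")
  case True
  then show ?thesis by (simp add: normal_law_def prob_space_return)
next
  case False
  then show ?thesis
    using assms prob_space_normal_density[of "sqrt v" \<mu>] by (simp add: normal_law_def phi_def)
qed

text \<open>For \<open>w = v\<close> the exponential turns the density of variance \<open>v\<close>
  into \<open>sqrt 2\<close> times the density of variance \<open>2 * v\<close>, so the integral is
  \<open>sqrt 2\<close>. The cruder bound \<open>exp 1\<close> makes the product over
  \<open>I\<close> equal to \<open>exp (card I)\<close>.\<close>

lemma nn_integral_normal_law_exp_le: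
  assumes "0 < v" "v \<le> w"
  shows "(\<integral>\<^sup>+x. ennreal (exp ((x - \<mu>)\<^sup>2 / (4 * w))) \<partial>normal_law \<mu> v) \<le> ennreal (exp 1)"
proof -
  have eq: "exp ((x - \<mu>)\<^sup>2 / (4 * v)) * phi x \<mu> v = sqrt 2 * normal_density \<mu> (sqrt (2 * v)) x" for x
  proof -
    have "(x - \<mu>)\<^sup>2 / (4 * v) + - (x - \<mu>)\<^sup>2 / (2 * v) = - (x - \<mu>)\<^sup>2 / (2 * (2 * v))"
      using assms(1) by (simp add: field_simps)
    then have "exp ((x - \<mu>)\<^sup>2 / (4 * v)) * exp (- (x - \<mu>)\<^sup>2 / (2 * v)) = exp (- (x - \<mu>)\<^sup>2 / (2 * (2 * v)))"
      by (simp only: exp_add[symmetric])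
    moreover have "(sqrt v)\<^sup>2 = v" "(sqrt (2 * v))\<^sup>2 = 2 * v"
      using assms(1) by simp_all
    ultimately show ?thesis
      using assms(1) unfolding phi_def normal_density_def by (simp add: real_sqrt_mult field_simps)
  qed
  have "(\<integral>\<^sup>+x. ennreal (exp ((x - \<mu>)\<^sup>2 / (4 * w))) \<partial>normal_law \<mu> v)
      \<le> (\<integral>\<^sup>+x. ennreal (exp ((x - \<mu>)\<^sup>2 / (4 * v))) \<partial>normal_law \<mu> v)"
    using assms by (intro nn_integral_mono ennreal_leI) (auto intro!: divide_left_mono)
  also have "\<dots> = (\<integral>\<^sup>+x. ennreal (phi x \<mu> v) * ennreal (exp ((x - \<mu>)\<^sup>2 / (4 * v))) \<partial>lborel)"
    using assms(1) by (simp add: normal_law_def phi_def nn_integral_density)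
  also have "\<dots> = (\<integral>\<^sup>+x. ennreal (sqrt 2) * ennreal (normal_density \<mu> (sqrt (2 * v)) x) \<partial>lborel)"
    using eq by (simp add: phi_def mult.commute flip: ennreal_mult)
  also have "\<dots> = ennreal (sqrt 2) * (\<integral>\<^sup>+x. ennreal (normal_density \<mu> (sqrt (2 * v)) x) \<partial>lborel)"
    by (intro nn_integral_cmult) auto
  also have "(\<integral>\<^sup>+x. ennreal (normal_density \<mu> (sqrt (2 * v)) x) \<partial>lborel) = 1"
    using assms(1) by (subst nn_integral_eq_integral) auto
  also have "ennreal (sqrt 2) * 1 \<le> ennreal (exp 1)"
  proof -
    have "sqrt 2 \<le> sqrt (2\<^sup>2)" by (intro real_sqrt_le_mono) auto
    also have "\<dots> \<le> exp 1" using exp_ge_add_one_self[of 1] by simp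
    finally show ?thesis by (simp add: ennreal_leI)
  qed
  finally show ?thesis .
qed

text \<open>From \<open>card I \<le> n\<close> follows \<open>Kn n I \<ge> e - 1 > 0\<close>, and
  the shrinkage factor \<open>Kn n I / (Kn n I + 1)\<close> then lies between 0 and 1.\<close>

lemma post_variance_bounds:
  assumes "I \<subseteq> {1..n}" "i \<in> I" "0 < \<sigma>"
  shows "0 < Kn n I * \<sigma>\<^sup>2 / (Kn n I + 1)" "Kn n I * \<sigma>\<^sup>2 / (Kn n I + 1) \<le> \<sigma>\<^sup>2"
proof -
  have k: "0 < card I" "card I \<le> n"
    using assms finite_subset[OF assms(1)] card_mono[OF _ assms(1)] by (auto simp: card_gt_0_iff)
  then have "exp 1 * 1 \<le> exp 1 * (real n / real (card I))" by (intro mult_left_mono) auto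
  then have "0 < Kn n I"
    using assms exp_ge_add_one_self[of 1] by (auto simp: Kn_def)
  then show "0 < Kn n I * \<sigma>\<^sup>2 / (Kn n I + 1)" "Kn n I * \<sigma>\<^sup>2 / (Kn n I + 1) \<le> \<sigma>\<^sup>2"
    using assms by (auto simp: field_simps)
qed

text \<open>Stated for every \<open>i\<close>, also outside \<open>{1..n}\<close>, because the
  locale of product measures asks for a sigma-finite measure at each index.\<close>

lemma prob_space_cond_post_factor:
  assumes "I \<subseteq> {1..n}" "0 < \<sigma>"
  shows "prob_space (normal_law (proj n X I i) (if i \<in> I then Kn n I * \<sigma>\<^sup>2 / (Kn n I + 1) else 0))"
  using post_variance_bounds[OF assms(1) _ assms(2), of i] by (auto intro!: prob_space_normal_law)

lemma sets_cond_post [simp]: "sets (cond_post n \<sigma> I X) = sets (Rn n)"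
  unfolding cond_post_def by (intro sets_PiM_cong) auto

lemma prob_space_cond_post:
  assumes "I \<subseteq> {1..n}" "0 < \<sigma>"
  shows "prob_space (cond_post n \<sigma> I X)"
  unfolding cond_post_def by (intro prob_space_PiM prob_space_cond_post_factor assms)

lemma sqdist_triangle: "sqdist n x z \<le> 2 * sqdist n x y + 2 * sqdist n y z"
proof -
  have "(x i - z i)\<^sup>2 \<le> 2 * (x i - y i)\<^sup>2 + 2 * (y i - z i)\<^sup>2" for i
    using zero_le_power2[of "(x i - y i) - (y i - z i)"] by (simp add: power2_eq_square algebra_simps)
  then show ?thesis
    unfolding sqdist_eq_sum by (simp add: sum_mono sum_distrib_left flip: sum.distrib)
qed

text \<open>A Chernoff bound. The distance to \<open>\<theta>\<close> is split at the centre
  \<open>m\<close>, which doubles both parts, so the rate \<open>\<beta> / 8\<close> becomes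
  \<open>\<beta> / 4\<close> on each. On the random part \<open>\<beta>\<close> is then raised to 1,
  and the exponential factorizes over the coordinates.\<close>

lemma measure_cond_post_le:
  assumes "I \<subseteq> {1..n}" "0 < \<sigma>" "0 < \<beta>" "\<beta> \<le> 1"
  shows "measure (cond_post n \<sigma> I X) {\<eta> \<in> space (Rn n). t * \<sigma>\<^sup>2 \<le> sqdist n \<eta> \<theta>}
    \<le> exp (- (\<beta> / 8) * t) * exp (real (card I)) * exp (\<beta> * (sqdist n (proj n X I) \<theta> / (4 * \<sigma>\<^sup>2)))"
    (is "measure ?P ?A \<le> _")
proof (cases "?A \<in> sets ?P")
  \<comment> \<open>A set outside the sigma-algebra has \<open>measure\<close> 0 by default, so the
    bound is trivial.\<close>
  case False
  then show ?thesis by (simp add: measure_notin_sets)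
next
  case True
  define m where "m = proj n X I"
  define L where "L = (\<lambda>i. normal_law (m i) (if i \<in> I then Kn n I * \<sigma>\<^sup>2 / (Kn n I + 1) else 0))"
  define K where "K = exp (- (\<beta> / 8) * t) * exp (\<beta> * (sqdist n m \<theta> / (4 * \<sigma>\<^sup>2)))"
  interpret L: prob_space "L i" for i
    unfolding L_def m_def by (intro prob_space_cond_post_factor assms)
  interpret P: product_sigma_finite L by unfold_locales
  interpret Q: prob_space ?P by (intro prob_space_cond_post assms)
  have P: "?P = Pi\<^sub>M {1..n} L" by (simp add: cond_post_def L_def m_def)
  have "indicator ?A \<eta> \<le> K * (\<Prod>i\<in>{1..n}. exp ((\<eta> i - m i)\<^sup>2 / (4 * \<sigma>\<^sup>2)))" for \<eta>
  proof (cases "\<eta> \<in> ?A")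
    case True
    then have "t \<le> sqdist n \<eta> \<theta> / \<sigma>\<^sup>2" using assms by (simp add: field_simps)
    also have "\<dots> \<le> (2 * sqdist n \<eta> m + 2 * sqdist n m \<theta>) / \<sigma>\<^sup>2"
      by (intro divide_right_mono sqdist_triangle) auto
    finally have "\<beta> / 8 * t \<le> \<beta> / 8 * ((2 * sqdist n \<eta> m + 2 * sqdist n m \<theta>) / \<sigma>\<^sup>2)"
      using assms by (intro mult_left_mono) auto
    also have "\<dots> = \<beta> * (sqdist n \<eta> m / (4 * \<sigma>\<^sup>2)) + \<beta> * (sqdist n m \<theta> / (4 * \<sigma>\<^sup>2))"
      using assms(2) by (simp add: field_simps)
    also have "\<beta> * (sqdist n \<eta> m / (4 * \<sigma>\<^sup>2)) \<le> 1 * (sqdist n \<eta> m / (4 * \<sigma>\<^sup>2))"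
      using assms by (intro mult_right_mono) (auto simp: sqdist_def)
    finally have "1 \<le> exp (- (\<beta> / 8) * t + \<beta> * (sqdist n m \<theta> / (4 * \<sigma>\<^sup>2)) + sqdist n \<eta> m / (4 * \<sigma>\<^sup>2))"
      by simp
    also have "\<dots> = K * exp (sqdist n \<eta> m / (4 * \<sigma>\<^sup>2))"
      unfolding K_def exp_add ..
    also have "exp (sqdist n \<eta> m / (4 * \<sigma>\<^sup>2)) = (\<Prod>i\<in>{1..n}. exp ((\<eta> i - m i)\<^sup>2 / (4 * \<sigma>\<^sup>2)))"
      by (simp add: sqdist_eq_sum sum_divide_distrib exp_sum)
    finally show ?thesis using True by simp
  qed (auto simp: K_def intro!: mult_nonneg_nonneg prod_nonneg)
  then have le: "indicator ?A \<eta> \<le> ennreal K * (\<Prod>i\<in>{1..n}. ennreal (exp ((\<eta> i - m i)\<^sup>2 / (4 * \<sigma>\<^sup>2))))" for \<eta>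
    by (subst prod_ennreal, simp, subst ennreal_mult[symmetric])
      (auto simp: K_def intro!: prod_nonneg ennreal_leI simp flip: ennreal_indicator)
  have meas: "(\<lambda>x. ennreal (exp ((x - m i)\<^sup>2 / (4 * \<sigma>\<^sup>2)))) \<in> borel_measurable (L i)" for i
  proof -
    have sets: "sets (L i) = sets borel" by (simp add: L_def)
    show ?thesis unfolding measurable_cong_sets[OF sets refl] by measurable
  qed
  have "(\<integral>\<^sup>+\<eta>. (\<Prod>i\<in>{1..n}. ennreal (exp ((\<eta> i - m i)\<^sup>2 / (4 * \<sigma>\<^sup>2)))) \<partial>?P)
      = (\<Prod>i\<in>{1..n}. \<integral>\<^sup>+x. ennreal (exp ((x - m i)\<^sup>2 / (4 * \<sigma>\<^sup>2))) \<partial>L i)"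
    unfolding P by (intro P.product_nn_integral_prod meas) auto
  also have "\<dots> \<le> (\<Prod>i\<in>{1..n}. ennreal (if i \<in> I then exp 1 else 1))"
  proof (intro prod_mono_ennreal)
    fix i assume "i \<in> {1..n}"
    show "(\<integral>\<^sup>+x. ennreal (exp ((x - m i)\<^sup>2 / (4 * \<sigma>\<^sup>2))) \<partial>L i) \<le> ennreal (if i \<in> I then exp 1 else 1)"
    proof (cases "i \<in> I")
      case True
      then show ?thesis
        using nn_integral_normal_law_exp_le[OF post_variance_bounds, OF assms(1) True assms(2) assms(1) True assms(2)]
        by (simp add: L_def)
    next
      case False
      \<comment> \<open>Outside \<open>I\<close> the factor is the Dirac measure at
        \<open>m i\<close>, where the integrand equals 1.\<close>
      then show ?thesis by (simp add: L_def normal_law_def nn_integral_return)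
    qed
  qed
  also have "\<dots> = ennreal (exp (real (card I)))"
    using assms(1) by (subst prod_ennreal) (auto simp: prod.If_cases Int_absorb1 simp flip: exp_of_nat_mult)
  finally have prod: "(\<integral>\<^sup>+\<eta>. (\<Prod>i\<in>{1..n}. ennreal (exp ((\<eta> i - m i)\<^sup>2 / (4 * \<sigma>\<^sup>2)))) \<partial>?P)
      \<le> ennreal (exp (real (card I)))" .
  have "emeasure ?P ?A = (\<integral>\<^sup>+\<eta>. indicator ?A \<eta> \<partial>?P)" using True by simp
  also have "\<dots> \<le> (\<integral>\<^sup>+\<eta>. ennreal K * (\<Prod>i\<in>{1..n}. ennreal (exp ((\<eta> i - m i)\<^sup>2 / (4 * \<sigma>\<^sup>2)))) \<partial>?P)"
    by (intro nn_integral_mono le)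
  also have "\<dots> = ennreal K * (\<integral>\<^sup>+\<eta>. (\<Prod>i\<in>{1..n}. ennreal (exp ((\<eta> i - m i)\<^sup>2 / (4 * \<sigma>\<^sup>2)))) \<partial>?P)"
    unfolding P using meas
    by (intro nn_integral_cmult borel_measurable_prod_ennreal
        measurable_compose[OF measurable_component_singleton]) auto
  also have "\<dots> \<le> ennreal K * ennreal (exp (real (card I)))"
    by (intro mult_left_mono prod) auto
  also have "\<dots> = ennreal (K * exp (real (card I)))"
    by (simp add: ennreal_mult K_def)
  finally show ?thesis
    unfolding Q.emeasure_eq_measure by (subst (asm) ennreal_le_iff) (auto simp: K_def m_def mult_ac)
qed

text \<open>Turns the monadic bind into the finite mixture that \<open>tail_bounds\<close>
  expects.\<close>

lemma measure_mix_post: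
  assumes "0 < \<sigma>" "A \<in> sets (Rn n)"
  shows "measure (mix_post n \<sigma> \<kappa> X) A
    = (\<Sum>I\<in>Pow {1..n}. post_weight n \<sigma> \<kappa> X I * measure (cond_post n \<sigma> I X) A)"
proof -
  let ?M = "point_measure (Pow {1..n}) (\<lambda>I. ennreal (post_weight n \<sigma> \<kappa> X I))"
  have prob: "prob_space (cond_post n \<sigma> I X)" if "I \<in> Pow {1..n}" for I
    using that assms by (auto intro!: prob_space_cond_post)
  have "emeasure (mix_post n \<sigma> \<kappa> X) A = (\<integral>\<^sup>+I. emeasure (cond_post n \<sigma> I X) A \<partial>?M)"
    unfolding mix_post_def
  proof (rule emeasure_bind)
    show "(\<lambda>I. cond_post n \<sigma> I X) \<in> ?M \<rightarrow>\<^sub>M subprob_algebra (Rn n)"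
      using prob by (auto simp: measurable_point_measure_eq1 space_subprob_algebra
          intro: prob_space_imp_subprob_space)
    show "A \<in> sets (Rn n)" by (rule assms)
  qed (auto simp: space_point_measure)
  also have "\<dots> = (\<Sum>I\<in>Pow {1..n}. ennreal (post_weight n \<sigma> \<kappa> X I) * emeasure (cond_post n \<sigma> I X) A)"
    by (intro nn_integral_point_measure_finite) simp
  also have "\<dots> = (\<Sum>I\<in>Pow {1..n}. ennreal (post_weight n \<sigma> \<kappa> X I * measure (cond_post n \<sigma> I X) A))"
  proof (intro sum.cong refl)
    fix I assume I: "I \<in> Pow {1..n}"
    then interpret prob_space "cond_post n \<sigma> I X" by (rule prob)
    show "ennreal (post_weight n \<sigma> \<kappa> X I) * emeasure (cond_post n \<sigma> I X) A
        = ennreal (post_weight n \<sigma> \<kappa> X I * measure (cond_post n \<sigma> I X) A)"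
      using I assms by (simp add: emeasure_eq_measure ennreal_mult post_weight_nonneg)
  qed
  also have "\<dots> = ennreal (\<Sum>I\<in>Pow {1..n}. post_weight n \<sigma> \<kappa> X I * measure (cond_post n \<sigma> I X) A)"
    using assms by (intro sum_ennreal) (auto intro!: mult_nonneg_nonneg post_weight_nonneg)
  finally show ?thesis
    using assms unfolding measure_def[of "mix_post n \<sigma> \<kappa> X"]
    by (auto intro!: enn2real_ennreal sum_nonneg mult_nonneg_nonneg post_weight_nonneg)
qed

subsection \<open>Tail bounds for the posterior and its mean\<close>

text \<open>Jensen's inequality for the square in each coordinate; as the weights sum to 1,
  \<open>\<theta> i\<close> can be moved inside the average.\<close>

lemma sqdist_convex_comb_le:
  assumes "\<And>I. I \<in> Pow {1..n} \<Longrightarrow> 0 \<le> w I" "(\<Sum>I\<in>Pow {1..n}. w I) = 1"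
    and "\<And>i. i \<in> {1..n} \<Longrightarrow> y i = (\<Sum>I\<in>Pow {1..n}. proj n X I i * w I)"
  shows "sqdist n y \<theta> \<le> (\<Sum>I\<in>Pow {1..n}. w I * sqdist n (proj n X I) \<theta>)"
proof -
  have "(y i - \<theta> i)\<^sup>2 \<le> (\<Sum>I\<in>Pow {1..n}. w I * (proj n X I i - \<theta> i)\<^sup>2)" if i: "i \<in> {1..n}" for i
  proof -
    have "y i - \<theta> i = (\<Sum>I\<in>Pow {1..n}. w I *\<^sub>R (proj n X I i - \<theta> i))"
      using assms(2) sum_distrib_left[of "\<theta> i" w "Pow {1..n}"] i
      by (simp add: assms(3) right_diff_distrib sum_subtractf mult.commute)
    then show ?thesis
      using convex_on_sum[OF _ _ convex_power2 assms(2,1), of "\<lambda>I. proj n X I i - \<theta> i"]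
      by (simp add: Pow_not_empty)
  qed
  then have "sqdist n y \<theta> \<le> (\<Sum>i\<in>{1..n}. \<Sum>I\<in>Pow {1..n}. w I * (proj n X I i - \<theta> i)\<^sup>2)"
    unfolding sqdist_eq_sum by (intro sum_mono)
  also have "\<dots> = (\<Sum>I\<in>Pow {1..n}. w I * sqdist n (proj n X I) \<theta>)"
    unfolding sqdist_eq_sum by (subst sum.swap) (simp add: sum_distrib_left)
  finally show ?thesis .
qed

text \<open>Markov's inequality: \<open>g\<close> dominates the indicator of \<open>A\<close>. For
  \<open>A\<close> outside the sigma-algebra the default value 0 gives the claim.\<close>

lemma measure_le_of_nn_integral_le:
  fixes g :: "'a \<Rightarrow> real"
  assumes "\<And>x. x \<in> A \<Longrightarrow> x \<in> space M \<Longrightarrow> 1 \<le> g x" "\<And>x. x \<in> space M \<Longrightarrow> 0 \<le> g x"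
    and "(\<integral>\<^sup>+x. ennreal (g x) \<partial>M) \<le> ennreal C" "0 \<le> C"
  shows "measure M A \<le> C"
proof (cases "A \<in> sets M")
  case True
  have "integral\<^sup>L M (indicator A :: 'a \<Rightarrow> real) \<le> C"
    using assms(1,2) by (intro integral_le_of_nn_integral_le[OF _ _ assms(3,4)])
      (auto simp: indicator_def)
  then show ?thesis using sets.sets_into_space[OF True] by (simp add: Int_absorb2)
qed (simp add: measure_notin_sets assms)

text \<open>
  \<open>v\<close> stands for the posterior weights of the subsets, or for the point mass at the selected
  subset; in both cases the posterior and its mean are the corresponding mixtures.
\<close>

lemma tail_bounds:
  fixes v :: "(nat \<Rightarrow> real) \<Rightarrow> nat set \<Rightarrow> real"
    and pihat :: "(nat \<Rightarrow> real) \<Rightarrow> (nat \<Rightarrow> real) measure"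
    and \<beta> \<kappa> B :: real
  defines "c \<equiv> \<beta> * (\<kappa> + 1/2) + B"
  assumes N: "noise_law n \<beta> B (N \<theta>)" and "0 < \<sigma>" "0 < \<beta>" "\<beta> \<le> 1" "0 < B"
    and \<kappa>: "3 + B \<le> \<beta> * (\<kappa> + 1/2)" and \<theta>: "\<theta> \<in> ell0 n p" and "p \<le> n"
    and v: "\<And>X I. X \<in> space (Rn n) \<Longrightarrow> I \<subseteq> {1..n} \<Longrightarrow> 0 \<le> v X I \<and> v X I \<le>
      exp (\<beta> * (log_weight n \<sigma> \<kappa> X I - log_weight n \<sigma> \<kappa> X {i \<in> {1..n}. \<theta> i \<noteq> 0}))"
    and v1: "\<And>X. X \<in> space (Rn n) \<Longrightarrow> (\<Sum>I\<in>Pow {1..n}. v X I) = 1"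
  shows "(\<And>X A. X \<in> space (Rn n) \<Longrightarrow> A \<in> sets (Rn n) \<Longrightarrow>
      measure (pihat X) A = (\<Sum>I\<in>Pow {1..n}. v X I * measure (cond_post n \<sigma> I X) A)) \<Longrightarrow>
    (\<integral>X. measure (pihat X) {\<eta> \<in> space (Rn n). (8 * c / \<beta> * rho n p + M) * \<sigma>\<^sup>2 \<le> sqdist n \<eta> \<theta>}
      \<partial>obs_law n \<sigma> N \<theta>) \<le> 2 * exp (- (\<beta> / 8) * M)"
    and "(\<And>X i. X \<in> space (Rn n) \<Longrightarrow> i \<in> {1..n} \<Longrightarrow>
      thetahat X i = (\<Sum>I\<in>Pow {1..n}. proj n X I i * v X I)) \<Longrightarrow>
    measure (obs_law n \<sigma> N \<theta>)
      {X \<in> space (Rn n). (4 * c / \<beta> * rho n p + M) * \<sigma>\<^sup>2 \<le> sqdist n (thetahat X) \<theta>}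
      \<le> 2 * exp (- (\<beta> / 4) * M)"
    and "(\<And>X. X \<in> space (Rn n) \<Longrightarrow> Ihat X \<subseteq> {1..n} \<and> v X (Ihat X) = 1) \<Longrightarrow>
    measure (obs_law n \<sigma> N \<theta>)
      {X \<in> space (Rn n). c * rho n p + M \<le> rho n (card (Ihat X))} \<le> 2 * exp (- M)"
proof -
  define D where "D X I = \<beta> * (sqdist n (proj n X I) \<theta> / (4 * \<sigma>\<^sup>2))" for X I
  define G where "G X = (\<Sum>I\<in>Pow {1..n}. exp (rho n (card I)) * v X I * exp (D X I))" for X
  \<comment> \<open>The scaling cancels the growth \<open>exp (c * rho n p)\<close> of the
    expectation of \<open>G\<close> and leaves the tail \<open>exp (- s)\<close>; the three claims
    differ only in \<open>s\<close>.\<close>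
  have "(\<integral>\<^sup>+X. ennreal (exp (- (c * rho n p) - s) * G X) \<partial>obs_law n \<sigma> N \<theta>)
      \<le> ennreal (exp (- (c * rho n p) - s) * (2 * exp (c * rho n p)))" for s
    unfolding G_def D_def c_def using assms by (intro nn_integral_weighted_sum_le) auto
  then have G: "(\<integral>\<^sup>+X. ennreal (exp (- (c * rho n p) - s) * G X) \<partial>obs_law n \<sigma> N \<theta>)
      \<le> ennreal (2 * exp (- s))" for s
    by (simp add: exp_diff exp_minus field_simps)
  have D: "0 \<le> D X I" for X I using assms by (simp add: D_def sqdist_def)
  have one_le: "1 \<le> exp (- (c * rho n p) - s) * g" if "exp (c * rho n p + s) \<le> g" for s g
    using mult_left_mono[OF that, of "exp (- (c * rho n p) - s)"] by (simp flip: exp_add)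
  have G0: "0 \<le> G X" if "X \<in> space (Rn n)" for X
    unfolding G_def using v[OF that] by (intro sum_nonneg) auto
  have card: "real (card I) \<le> rho n (card I)" if "I \<in> Pow {1..n}" for I
    using that card_mono[of "{1..n}" I] by (intro card_le_rho) auto
  have vG: "(\<Sum>I\<in>Pow {1..n}. v X I * exp (D X I)) \<le> G X" if X: "X \<in> space (Rn n)" for X
    unfolding G_def
  proof (intro sum_mono)
    fix I assume I: "I \<in> Pow {1..n}"
    have "1 * v X I \<le> exp (rho n (card I)) * v X I"
      using v[OF X, of I] I order_trans[OF _ card[OF I], of 0] by (intro mult_right_mono) auto
    then show "v X I * exp (D X I) \<le> exp (rho n (card I)) * v X I * exp (D X I)"
      by (intro mult_right_mono) auto
  qed

  show "(\<integral>X. measure (pihat X) {\<eta> \<in> space (Rn n). (8 * c / \<beta> * rho n p + M) * \<sigma>\<^sup>2 \<le> sqdist n \<eta> \<theta>}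
      \<partial>obs_law n \<sigma> N \<theta>) \<le> 2 * exp (- (\<beta> / 8) * M)" (is "(\<integral>X. measure (pihat X) ?A \<partial>_) \<le> _")
    if pihat: "\<And>X A. X \<in> space (Rn n) \<Longrightarrow> A \<in> sets (Rn n) \<Longrightarrow>
      measure (pihat X) A = (\<Sum>I\<in>Pow {1..n}. v X I * measure (cond_post n \<sigma> I X) A)"
  proof (rule integral_le_of_nn_integral_le)
    fix X assume "X \<in> space (obs_law n \<sigma> N \<theta>)"
    then have X: "X \<in> space (Rn n)" by simp
    have A: "?A \<in> sets (Rn n)" unfolding sqdist_eq_sum by measurable
    define K where "K = exp (- (c * rho n p) - \<beta> / 8 * M)"
    \<comment> \<open>The constant \<open>8 * c / \<beta>\<close> is chosen so that the Chernoff
      rate \<open>\<beta> / 8\<close> turns it into exactly \<open>c\<close>.\<close>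
    have K: "exp (- (\<beta> / 8) * (8 * c / \<beta> * rho n p + M)) = K"
      using assms by (simp add: K_def field_simps)
    have "measure (pihat X) ?A \<le> (\<Sum>I\<in>Pow {1..n}. v X I * (K * exp (rho n (card I)) * exp (D X I)))"
      unfolding pihat[OF X A]
    proof (intro sum_mono mult_left_mono)
      fix I assume I: "I \<in> Pow {1..n}"
      have "measure (cond_post n \<sigma> I X) ?A \<le> K * exp (real (card I)) * exp (D X I)"
        using measure_cond_post_le[of I n \<sigma> \<beta> X "8 * c / \<beta> * rho n p + M" \<theta>] I assms
        unfolding K D_def by auto
      also have "\<dots> \<le> K * exp (rho n (card I)) * exp (D X I)"
        using card[OF I] by (intro mult_right_mono mult_left_mono) (auto simp: K_def)
      finally show "measure (cond_post n \<sigma> I X) ?A \<le> K * exp (rho n (card I)) * exp (D X I)" .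
      show "0 \<le> v X I" using v[OF X, of I] I by auto
    qed
    also have "\<dots> = K * G X"
      by (simp add: G_def sum_distrib_left mult_ac)
    finally show "measure (pihat X) ?A \<le> exp (- (c * rho n p) - \<beta> / 8 * M) * G X"
      by (simp add: K_def)
  qed (use G[of "\<beta> / 8 * M"] in auto)

  show "measure (obs_law n \<sigma> N \<theta>)
      {X \<in> space (Rn n). (4 * c / \<beta> * rho n p + M) * \<sigma>\<^sup>2 \<le> sqdist n (thetahat X) \<theta>}
      \<le> 2 * exp (- (\<beta> / 4) * M)"
    if thetahat: "\<And>X i. X \<in> space (Rn n) \<Longrightarrow> i \<in> {1..n} \<Longrightarrow>
      thetahat X i = (\<Sum>I\<in>Pow {1..n}. proj n X I i * v X I)"
  proof (rule measure_le_of_nn_integral_le)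
    fix X assume "X \<in> {X \<in> space (Rn n). (4 * c / \<beta> * rho n p + M) * \<sigma>\<^sup>2 \<le> sqdist n (thetahat X) \<theta>}"
    then have X: "X \<in> space (Rn n)"
      and le: "4 * c / \<beta> * rho n p + M \<le> sqdist n (thetahat X) \<theta> / \<sigma>\<^sup>2"
      using assms by (auto simp: field_simps)
    have w: "0 \<le> v X I" if "I \<in> Pow {1..n}" for I using v[OF X, of I] that by auto
    \<comment> \<open>The rate is \<open>\<beta> / 4\<close> as in \<open>D\<close>, twice that of
      the posterior, because no splitting of the distance occurs. Jensen's inequality is applied
      twice below, to the square and then to the exponential.\<close>
    have "c * rho n p + \<beta> / 4 * M = \<beta> / 4 * (4 * c / \<beta> * rho n p + M)"
      using assms by (simp add: field_simps)
    also have "\<dots> \<le> \<beta> / 4 * (sqdist n (thetahat X) \<theta> / \<sigma>\<^sup>2)"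
      using le assms by (intro mult_left_mono) auto
    also have "\<dots> \<le> \<beta> / 4 * ((\<Sum>I\<in>Pow {1..n}. v X I * sqdist n (proj n X I) \<theta>) / \<sigma>\<^sup>2)"
      using assms by (intro mult_left_mono divide_right_mono sqdist_convex_comb_le w v1 thetahat X) auto
    also have "\<dots> = (\<Sum>I\<in>Pow {1..n}. v X I *\<^sub>R D X I)"
      by (simp add: D_def sum_distrib_left sum_divide_distrib mult_ac)
    finally have "exp (c * rho n p + \<beta> / 4 * M) \<le> exp (\<Sum>I\<in>Pow {1..n}. v X I *\<^sub>R D X I)"
      by simp
    also have "\<dots> \<le> (\<Sum>I\<in>Pow {1..n}. v X I * exp (D X I))"
      by (intro convex_on_sum[OF _ _ exp_convex] v1 w X) auto
    also have "\<dots> \<le> G X" by (rule vG[OF X])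
    finally show "1 \<le> exp (- (c * rho n p) - \<beta> / 4 * M) * G X"
      by (rule one_le)
  qed (use G0 G[of "\<beta> / 4 * M"] in auto)

  show "measure (obs_law n \<sigma> N \<theta>)
      {X \<in> space (Rn n). c * rho n p + M \<le> rho n (card (Ihat X))} \<le> 2 * exp (- M)"
    if Ihat: "\<And>X. X \<in> space (Rn n) \<Longrightarrow> Ihat X \<subseteq> {1..n} \<and> v X (Ihat X) = 1"
  proof (rule measure_le_of_nn_integral_le)
    fix X assume "X \<in> {X \<in> space (Rn n). c * rho n p + M \<le> rho n (card (Ihat X))}"
    then have X: "X \<in> space (Rn n)" and le: "c * rho n p + M \<le> rho n (card (Ihat X))" by auto
    let ?g = "\<lambda>I. exp (rho n (card I)) * v X I * exp (D X I)"
    \<comment> \<open>A single summand of \<open>G\<close> suffices: at the selected subset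
      \<open>v\<close> is 1 and the factor \<open>exp (rho n (card I))\<close> is the quantity to be
      bounded.\<close>
    have "exp (c * rho n p + M) \<le> exp (rho n (card (Ihat X))) * exp (D X (Ihat X))"
      using le D[of X "Ihat X"] by (simp flip: exp_add)
    also have "\<dots> = ?g (Ihat X)" using Ihat[OF X] by simp
    also have "\<dots> \<le> G X"
      unfolding G_def using Ihat[OF X] v[OF X] by (intro member_le_sum) auto
    finally show "1 \<le> exp (- (c * rho n p) - M) * G X"
      by (rule one_le)
  qed (use G0 G[of M] in auto)
qed

section \<open>Uniform bounds over the sparsity class\<close>

theorem corollary1:
  fixes \<beta> B \<kappa> :: real
  assumes "0 < \<beta>" and "\<beta> \<le> 1" and "0 < B" and "1 < \<kappa>"
    and "\<kappa> > (12 - \<beta> + 4 * B) / (4 * \<beta>)"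
  shows "\<exists>M0 H0 m0 M1 H1 m1 M0' H0' :: real.
    0 < M0 \<and> 0 < H0 \<and> 0 < m0 \<and> 0 < M1 \<and> 0 < H1 \<and> 0 < m1 \<and> 0 < M0' \<and> 0 < H0' \<and>
    (\<forall>p :: nat \<Rightarrow> nat. (\<forall>n\<ge>1. p n \<in> {1..n}) \<longrightarrow> (\<lambda>n. real (p n)) \<in> o(\<lambda>n. real n) \<longrightarrow>
      (\<forall>n\<ge>1. \<forall>\<sigma>>0. \<forall>N Ihat pihat thetahat.
        (\<forall>\<theta>\<in>space (Rn n). noise_law n \<beta> B (N \<theta>)) \<longrightarrow>
        selector n \<sigma> \<kappa> Ihat \<longrightarrow>
        (pihat, thetahat) \<in> {(mix_post n \<sigma> \<kappa>, mix_mean n \<sigma> \<kappa>),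
                               (sel_post n \<sigma> Ihat, sel_mean n Ihat)} \<longrightarrow>
        (\<forall>M\<ge>0.
          (SUP \<theta>\<in>ell0 n (p n). \<integral>X. measure (pihat X)
              {\<eta> \<in> space (Rn n). sqdist n \<eta> \<theta>
                 \<ge> M0 * \<sigma>\<^sup>2 * real (p n) * ln (exp 1 * real n / real (p n)) + M * \<sigma>\<^sup>2}
              \<partial>obs_law n \<sigma> N \<theta>)
            \<le> H0 * exp (- m0 * M) \<and>
          (SUP \<theta>\<in>ell0 n (p n). measure (obs_law n \<sigma> N \<theta>)
              {X \<in> space (Rn n). sqdist n (thetahat X) \<theta>
                 \<ge> M1 * \<sigma>\<^sup>2 * real (p n) * ln (exp 1 * real n / real (p n)) + M * \<sigma>\<^sup>2})
            \<le> H1 * exp (- m1 * M) \<and>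
          (SUP \<theta>\<in>ell0 n (p n). measure (obs_law n \<sigma> N \<theta>)
              {X \<in> space (Rn n). rhat2 n \<sigma> Ihat X
                 \<ge> M0' * \<sigma>\<^sup>2 * real (p n) * ln (exp 1 * real n / real (p n)) + (M + 1) * \<sigma>\<^sup>2})
            \<le> H0' * exp (- M))))"
proof -
  define c where "c = \<beta> * (\<kappa> + 1/2) + B"
  \<comment> \<open>Multiplied by \<open>\<beta>\<close> the assumption reads
    \<open>\<beta> * \<kappa> > 3 + B - \<beta> / 4\<close>; adding \<open>\<beta> / 2\<close>
    leaves \<open>\<beta> / 4\<close> to spare.\<close>
  have \<kappa>: "3 + B \<le> \<beta> * (\<kappa> + 1/2)"
    using assms by (simp add: field_simps)
  then have c: "0 < c" using assms by (simp add: c_def)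
  have main: "(SUP \<theta>\<in>ell0 n p. \<integral>X. measure (pihat X)
        {\<eta> \<in> space (Rn n). sqdist n \<eta> \<theta>
           \<ge> (8 * c / \<beta>) * \<sigma>\<^sup>2 * real p * ln (exp 1 * real n / real p) + M * \<sigma>\<^sup>2}
        \<partial>obs_law n \<sigma> N \<theta>) \<le> 2 * exp (- (\<beta> / 8) * M) \<and>
      (SUP \<theta>\<in>ell0 n p. measure (obs_law n \<sigma> N \<theta>)
        {X \<in> space (Rn n). sqdist n (thetahat X) \<theta>
           \<ge> (4 * c / \<beta>) * \<sigma>\<^sup>2 * real p * ln (exp 1 * real n / real p) + M * \<sigma>\<^sup>2})
        \<le> 2 * exp (- (\<beta> / 4) * M) \<and>
      (SUP \<theta>\<in>ell0 n p. measure (obs_law n \<sigma> N \<theta>)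
        {X \<in> space (Rn n). rhat2 n \<sigma> Ihat X
           \<ge> c * \<sigma>\<^sup>2 * real p * ln (exp 1 * real n / real p) + (M + 1) * \<sigma>\<^sup>2})
        \<le> 2 * exp (- M)"
    if p: "p \<le> n" and \<sigma>: "0 < \<sigma>"
      and N: "\<forall>\<theta>\<in>space (Rn n). noise_law n \<beta> B (N \<theta>)" and sel: "selector n \<sigma> \<kappa> Ihat"
      and post: "(pihat, thetahat) \<in> {(mix_post n \<sigma> \<kappa>, mix_mean n \<sigma> \<kappa>),
        (sel_post n \<sigma> Ihat, sel_mean n Ihat)}"
    for n p :: nat and \<sigma> M :: real and N Ihat pihat thetahat
  proof -
    define vmix where "vmix = post_weight n \<sigma> \<kappa>"
    define vsel where "vsel X I = (if I = Ihat X then 1 else 0 :: real)" for X I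
    have sel_sub: "Ihat X \<in> Pow {1..n}" if "X \<in> space (Rn n)" for X
      using selector_log_weight_le(1)[OF sel that _ \<sigma>, of "{}"] by simp
    have vmix: "0 \<le> vmix X I \<and> vmix X I \<le>
        exp (\<beta> * (log_weight n \<sigma> \<kappa> X I - log_weight n \<sigma> \<kappa> X {i \<in> {1..n}. \<theta> i \<noteq> 0}))"
      if "I \<subseteq> {1..n}" for X I and \<theta> :: "nat \<Rightarrow> real"
      unfolding vmix_def using that assms \<sigma>
      by (intro conjI post_weight_nonneg post_weight_le) auto
    \<comment> \<open>At the selected subset the exponent is nonnegative by maximality, so the right
      side is at least 1; at all others \<open>vsel\<close> is 0.\<close>
    have vsel: "0 \<le> vsel X I \<and> vsel X I \<le>
        exp (\<beta> * (log_weight n \<sigma> \<kappa> X I - log_weight n \<sigma> \<kappa> X {i \<in> {1..n}. \<theta> i \<noteq> 0}))"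
      if "X \<in> space (Rn n)" for X I and \<theta> :: "nat \<Rightarrow> real"
    proof -
      have "{i \<in> {1..n}. \<theta> i \<noteq> 0} \<subseteq> {1..n}" by blast
      from selector_log_weight_le(2)[OF sel that this \<sigma>] show ?thesis
        using assms(1) by (auto simp: vsel_def intro!: mult_nonneg_nonneg)
    qed
    have vsel_sum: "(\<Sum>I\<in>Pow {1..n}. f I * vsel X I) = f (Ihat X)"
      "(\<Sum>I\<in>Pow {1..n}. vsel X I * f I) = f (Ihat X)" if "X \<in> space (Rn n)" for X and f :: "nat set \<Rightarrow> real"
    proof -
      have "(\<Sum>I\<in>Pow {1..n}. f I * vsel X I) = (\<Sum>I\<in>Pow {1..n}. if I = Ihat X then f I else 0)"
        by (intro sum.cong) (auto simp: vsel_def)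
      also have "\<dots> = f (Ihat X)" using sel_sub[OF that] by (subst sum.delta) auto
      finally show "(\<Sum>I\<in>Pow {1..n}. f I * vsel X I) = f (Ihat X)" .
      then show "(\<Sum>I\<in>Pow {1..n}. vsel X I * f I) = f (Ihat X)" by (simp add: mult.commute)
    qed
    have vsel1: "(\<Sum>I\<in>Pow {1..n}. vsel X I) = 1" if "X \<in> space (Rn n)" for X
      using vsel_sum(1)[OF that, of "\<lambda>_. 1"] by simp
    have vmix1: "(\<Sum>I\<in>Pow {1..n}. vmix X I) = 1" for X
      unfolding vmix_def by (rule sum_post_weight[OF \<sigma>])
    \<comment> \<open>The zero vector shows that the class is nonempty, as required to bound a real
      supremum by a common upper bound.\<close>
    have "{i \<in> {1..n}. (\<lambda>i\<in>{1..n}. 0 :: real) i \<noteq> 0} = {}" by auto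
    then have "(\<lambda>i\<in>{1..n}. 0) \<in> ell0 n p" 
      unfolding ell0_def mem_Collect_eq by (simp only:) (simp add: space_PiM)
    then have ne: "ell0 n p \<noteq> {}" by blast
    have N: "noise_law n \<beta> B (N \<theta>)" if "\<theta> \<in> ell0 n p" for \<theta>
      using N that by (auto simp: ell0_def)
    have thr: "a * \<sigma>\<^sup>2 * real p * ln (exp 1 * real n / real p) + M * \<sigma>\<^sup>2 = (a * rho n p + M) * \<sigma>\<^sup>2" for a
      by (simp add: rho_def algebra_simps)
    \<comment> \<open>The summand \<open>\<sigma>\<^sup>2\<close> of \<open>rhat2\<close> accounts
      for the 1 in \<open>M + 1\<close>, and the common factor \<open>\<sigma>\<^sup>2\<close>
      cancels.\<close>
    have thr': "c * \<sigma>\<^sup>2 * real p * ln (exp 1 * real n / real p) + (M + 1) * \<sigma>\<^sup>2 \<le> rhat2 n \<sigma> Ihat X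
        \<longleftrightarrow> c * rho n p + M \<le> rho n (card (Ihat X))" for X
    proof -
      have "rhat2 n \<sigma> Ihat X = (rho n (card (Ihat X)) + 1) * \<sigma>\<^sup>2"
        by (simp add: rhat2_def rho_def algebra_simps)
      moreover have "c * \<sigma>\<^sup>2 * real p * ln (exp 1 * real n / real p) + (M + 1) * \<sigma>\<^sup>2
          = (c * rho n p + M + 1) * \<sigma>\<^sup>2"
        by (simp add: rho_def algebra_simps)
      ultimately show ?thesis using \<sigma> by simp
    qed
    obtain v where v: "\<And>X I (\<theta> :: nat \<Rightarrow> real). X \<in> space (Rn n) \<Longrightarrow> I \<subseteq> {1..n} \<Longrightarrow> 0 \<le> v X I \<and> v X I \<le>
        exp (\<beta> * (log_weight n \<sigma> \<kappa> X I - log_weight n \<sigma> \<kappa> X {i \<in> {1..n}. \<theta> i \<noteq> 0}))"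
      and v1: "\<And>X. X \<in> space (Rn n) \<Longrightarrow> (\<Sum>I\<in>Pow {1..n}. v X I) = 1"
      and v_post: "\<And>X A. X \<in> space (Rn n) \<Longrightarrow> A \<in> sets (Rn n) \<Longrightarrow>
        measure (pihat X) A = (\<Sum>I\<in>Pow {1..n}. v X I * measure (cond_post n \<sigma> I X) A)"
      and v_mean: "\<And>X i. X \<in> space (Rn n) \<Longrightarrow> i \<in> {1..n} \<Longrightarrow>
        thetahat X i = (\<Sum>I\<in>Pow {1..n}. proj n X I i * v X I)"
    proof -
      consider (mix) "pihat = mix_post n \<sigma> \<kappa>" "thetahat = mix_mean n \<sigma> \<kappa>"
        | (sel) "pihat = sel_post n \<sigma> Ihat" "thetahat = sel_mean n Ihat"
        using post by auto
      then show thesis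
      proof cases
        case mix
        show thesis
        proof (rule that[of vmix])
          show "measure (pihat X) A = (\<Sum>I\<in>Pow {1..n}. vmix X I * measure (cond_post n \<sigma> I X) A)"
            if "A \<in> sets (Rn n)" for X A
            unfolding mix vmix_def using \<sigma> that by (rule measure_mix_post)
          show "thetahat X i = (\<Sum>I\<in>Pow {1..n}. proj n X I i * vmix X I)" if "i \<in> {1..n}" for X i
            unfolding mix vmix_def using that by (simp add: mix_mean_def)
        qed (assumption | rule vmix vmix1)+
      next
        case sel
        show thesis
        proof (rule that[of vsel])
          show "measure (pihat X) A = (\<Sum>I\<in>Pow {1..n}. vsel X I * measure (cond_post n \<sigma> I X) A)"
            if "X \<in> space (Rn n)" for X A
            unfolding sel vsel_sum(2)[OF that] sel_post_def ..
          show "thetahat X i = (\<Sum>I\<in>Pow {1..n}. proj n X I i * vsel X I)"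
            if "X \<in> space (Rn n)" for X i
            unfolding sel vsel_sum(1)[OF that] sel_mean_def ..
        qed (assumption | rule vsel vsel1)+
      qed
    qed
    have 1: "(\<integral>X. measure (pihat X) {\<eta> \<in> space (Rn n). (8 * c / \<beta> * rho n p + M) * \<sigma>\<^sup>2 \<le> sqdist n \<eta> \<theta>}
        \<partial>obs_law n \<sigma> N \<theta>) \<le> 2 * exp (- (\<beta> / 8) * M)"
      if \<theta>: "\<theta> \<in> ell0 n p" for \<theta>
      unfolding c_def
      by (rule tail_bounds(1)[where v = v and N = N and \<theta> = \<theta> and pihat = pihat,
        OF N[OF \<theta>] \<sigma> assms(1-3) \<kappa> \<theta> p v v1 v_post])
    have 2: "measure (obs_law n \<sigma> N \<theta>)
        {X \<in> space (Rn n). (4 * c / \<beta> * rho n p + M) * \<sigma>\<^sup>2 \<le> sqdist n (thetahat X) \<theta>}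
        \<le> 2 * exp (- (\<beta> / 4) * M)"
      if \<theta>: "\<theta> \<in> ell0 n p" for \<theta>
      unfolding c_def
      by (rule tail_bounds(2)[where v = v and N = N and \<theta> = \<theta> and thetahat = thetahat,
        OF N[OF \<theta>] \<sigma> assms(1-3) \<kappa> \<theta> p v v1 v_mean])
    \<comment> \<open>The radius depends on the data through \<open>Ihat\<close> alone, so
      \<open>vsel\<close> serves here for both choices of the posterior.\<close>
    have 3: "measure (obs_law n \<sigma> N \<theta>)
        {X \<in> space (Rn n). c * rho n p + M \<le> rho n (card (Ihat X))} \<le> 2 * exp (- M)"
      if \<theta>: "\<theta> \<in> ell0 n p" for \<theta>
      unfolding c_def
      by (rule tail_bounds(3)[where v = vsel and N = N and \<theta> = \<theta> and Ihat = Ihat,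
        OF N[OF \<theta>] \<sigma> assms(1-3) \<kappa> \<theta> p vsel vsel1])
        (use sel_sub in \<open>auto simp: vsel_def\<close>)
    show ?thesis
      unfolding thr thr' 
      by (intro conjI; rule cSUP_least[OF ne]; (rule 1 | rule 2 | rule 3); assumption)
  qed
  have p_le: "p n \<le> n" if "\<forall>n\<ge>1. p n \<in> {1..n}" "1 \<le> n" for p :: "nat \<Rightarrow> nat" and n
    using that by auto
  \<comment> \<open>The constants depend on \<open>\<beta>\<close>, \<open>B\<close> and
    \<open>\<kappa>\<close> only, through \<open>c\<close>. Each prefactor 2 is the bound of
    \<open>sum_subsets_exp_rho_le\<close>.\<close>
  show ?thesis
    by (rule exI[of _ "8 * c / \<beta>"], rule exI[of _ 2], rule exI[of _ "\<beta> / 8"],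
        rule exI[of _ "4 * c / \<beta>"], rule exI[of _ 2], rule exI[of _ "\<beta> / 4"],
        rule exI[of _ c], rule exI[of _ 2], intro conjI allI impI)
      ((rule main[THEN conjunct1] main[THEN conjunct2, THEN conjunct1]
          main[THEN conjunct2, THEN conjunct2], (assumption | rule p_le)+)
        | (use assms(1) c in simp; fail))+
qed

end
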